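(* Let $n$ be a positive integer and let $\lambda=(1^{m_1}2^{m_2}\cdots)$ be a partition of $n$ (with $m_i$ parts of size $i$ for each $i\ge 1$). Let $\mathfrak{S}_n(\lambda)$ be the set of permutations in $\mathfrak{S}_n$ of cycle type $\lambda$, and let $z_\lambda=\prod_{i\ge1} i^{m_i}m_i!$. Then $$\sum_{\pi\in\mathfrak{S}_n(\lambda)} s^{\mathrm{cval}(\pi)}t^{\mathrm{exc}(\pi)}=\frac{n!}{z_\lambda}\left(\frac{1+u}{1+uv}\right)^{n-m_1}\prod_{i\ge1}\left[\frac{A_{i-1}(v)}{(i-1)!}\right]^{m_i},$$ where $$u=\frac{1+t^2-2st-(1-t)\sqrt{(1+t)^2-4st}}{2(1-s)t},\qquad v=\frac{(1+t)^2-2st-(1+t)\sqrt{(1+t)^2-4st}}{2st}.$$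
   Context: $[n]=\{1,\dots,n\}$ and $\mathfrak{S}_n$ is the symmetric group on $[n]$. For $\pi\in\mathfrak{S}_n$, an excedance of $\pi$ is an $i\in[n]$ with $i<\pi(i)$, and $\mathrm{exc}(\pi)$ is the number of excedances. A cyclic valley of $\pi$ is an $i\in[n]$ with $\pi^{-1}(i)>i<\pi(i)$, and $\mathrm{cval}(\pi)$ is the number of cyclic valleys. The Eulerian polynomials are $A_0(t)=1$ and, for $n\ge1$, $A_n(t)=\sum_{\pi\in\mathfrak{S}_n}t^{\mathrm{des}(\pi)+1}=\sum_{\pi\in\mathfrak{S}_n}t^{\mathrm{exc}(\pi)+1}$, where $\mathrm{des}(\pi)$ is the number of $i\in[n-1]$ with $\pi(i)>\pi(i+1)$. The identity is understood in the ring of formal power series in $t$ with coefficients in $\mathbb{Q}[s]$; $\sqrt{(1+t)^2-4st}$ denotes the power series in $t$ with constant term $1$ (then $u$ and $v$ are well-defined power series in $t$ with coefficients in $\mathbb{Q}[s]$ and zero constant term). *)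

theory Defs
  imports
    "HOL-Computational_Algebra.Computational_Algebra"
    "HOL-Combinatorics.Combinatorics"
    "HOL-Combinatorics.Orbits"
begin

section \<open>Partitions and permutation statistics\<close>

definition partition_of :: "nat multiset \<Rightarrow> nat \<Rightarrow> bool" where
  "partition_of lam n \<longleftrightarrow> 0 \<notin># lam \<and> sum_mset lam = n"

definition z_partition :: "nat multiset \<Rightarrow> nat" where
  "z_partition lam = (\<Prod>i\<in>set_mset lam. i ^ count lam i * fact (count lam i))"

(* Fixed points count as cycles: for a permutation of [n], x lies in its own orbit, so the
   orbit of a fixed point x is {x}. *)
definition cycle_type :: "nat \<Rightarrow> (nat \<Rightarrow> nat) \<Rightarrow> nat multiset" where
  "cycle_type n \<pi> = image_mset card (mset_set (orbit \<pi> ` {1..n}))"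

definition perms_of_type :: "nat \<Rightarrow> nat multiset \<Rightarrow> (nat \<Rightarrow> nat) set" where
  "perms_of_type n lam = {\<pi>. \<pi> permutes {1..n} \<and> cycle_type n \<pi> = lam}"

definition exc :: "nat \<Rightarrow> (nat \<Rightarrow> nat) \<Rightarrow> nat" where
  "exc n \<pi> = card {i \<in> {1..n}. i < \<pi> i}"

definition cval :: "nat \<Rightarrow> (nat \<Rightarrow> nat) \<Rightarrow> nat" where
  "cval n \<pi> = card {i \<in> {1..n}. inv \<pi> i > i \<and> i < \<pi> i}"

definition des :: "nat \<Rightarrow> (nat \<Rightarrow> nat) \<Rightarrow> nat" where
  "des n \<pi> = card {i \<in> {1..<n}. \<pi> i > \<pi> (i + 1)}"

(* Polymorphic in the coefficients, so that it can be evaluated at a power series. *)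
definition eulerian_poly :: "nat \<Rightarrow> 'a::comm_semiring_1 poly" where
  "eulerian_poly n =
     (if n = 0 then 1 else (\<Sum>\<pi> | \<pi> permutes {1..n}. monom 1 (des n \<pi> + 1)))"


section \<open>Power series in t over the polynomial ring in s\<close>

type_synonym qs_fps = "rat poly fps"

definition rat_const :: "rat \<Rightarrow> qs_fps" where
  "rat_const c = fps_const [:c:]"

definition s_var :: qs_fps where "s_var = fps_const [:0, 1:]"

definition t_var :: qs_fps where "t_var = fps_X"

(* The library's division of power series needs a field of coefficients, whereas here
   the coefficients are polynomials in s. All quotients and the square root used below
   are shown to exist at the end of this theory. *)
definition exact_quot :: "'a::idom \<Rightarrow> 'a \<Rightarrow> 'a" where
  "exact_quot a b = (THE q. q * b = a)"

definition fps_sqrt :: "'a::idom fps \<Rightarrow> 'a fps" where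
  "fps_sqrt a = (THE r. r ^ 2 = a \<and> fps_nth r 0 = 1)"

definition root_ser :: qs_fps where
  "root_ser = fps_sqrt ((1 + t_var) ^ 2 - 4 * s_var * t_var)"

definition u_ser :: qs_fps where
  "u_ser = exact_quot
     (1 + t_var ^ 2 - 2 * s_var * t_var - (1 - t_var) * root_ser)
     (2 * (1 - s_var) * t_var)"

definition v_ser :: qs_fps where
  "v_ser = exact_quot
     ((1 + t_var) ^ 2 - 2 * s_var * t_var - (1 + t_var) * root_ser)
     (2 * s_var * t_var)"


section \<open>Well-definedness of the square root and the quotients\<close>

lemma exact_quot_eqI:
  fixes a b q :: "'a::idom"
  assumes "q * b = a" "b \<noteq> 0"
  shows "exact_quot a b = q"
  unfolding exact_quot_def using assms by (intro the_equality) auto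

lemma fps_quadratic_fixpoint:
  fixes a b c :: "'a::comm_ring_1 fps"
  shows "\<exists>f. f = a + fps_X * (b * f + c * f ^ 2)"
proof -
  define G where "G = (\<lambda>f. a + fps_X * (b * f + c * f ^ 2))"
  define w where "w = (\<lambda>k. (G ^^ k) 0)"
  have step: "\<forall>j<Suc k. fps_nth (G f) j = fps_nth (G g) j"
    if *: "\<forall>j<k. fps_nth f j = fps_nth g j" for f g k
  proof (intro allI impI)
    fix j assume j: "j < Suc k"
    have sq: "fps_nth (f ^ 2) i = fps_nth (g ^ 2) i" if "i < k" for i
      unfolding power2_eq_square fps_mult_nth using that * by (intro sum.cong) auto
    have "fps_nth (b * f + c * f ^ 2) i = fps_nth (b * g + c * g ^ 2) i" if "i < k" for i
      unfolding fps_add_nth fps_mult_nth using that * sq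
      by (intro arg_cong2[where f = "(+)"] sum.cong) auto
    then show "fps_nth (G f) j = fps_nth (G g) j"
      using j by (cases j) (auto simp: G_def)
  qed
  have w_Suc: "w (Suc k) = G (w k)" for k
    by (simp add: w_def)
  have near: "\<forall>j<k. fps_nth (w (Suc k)) j = fps_nth (w k) j" for k
  proof (induction k)
    case (Suc k)
    then show ?case using step[of k "w (Suc k)" "w k"] by (simp only: w_Suc)
  qed simp
  have far: "fps_nth (w (k + d)) j = fps_nth (w k) j" if "j < k" for j k d
  proof (induction d)
    case (Suc d)
    then show ?case using near[of "k + d"] that by auto
  qed simp
  define f where "f = Abs_fps (\<lambda>j. fps_nth (w (Suc j)) j)"
  have f_w: "\<forall>j<k. fps_nth f j = fps_nth (w k) j" for k
  proof (intro allI impI)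
    fix j assume "j < k"
    then obtain d where "k = Suc j + d"
      by (metis Suc_leI le_Suc_ex)
    then show "fps_nth f j = fps_nth (w k) j"
      using far[of j "Suc j" d] by (simp add: f_def)
  qed
  have "f = G f"
  proof (rule fps_ext)
    fix n
    have "fps_nth (G f) n = fps_nth (G (w n)) n"
      using step[OF f_w[of n]] by simp
    also have "\<dots> = fps_nth f n"
      using f_w[of "Suc n"] by (simp add: w_Suc)
    finally show "fps_nth f n = fps_nth (G f) n" by simp
  qed
  then show ?thesis
    by (auto simp: G_def)
qed

lemma fps_square_eq:
  fixes f g :: qs_fps
  assumes "f ^ 2 = g ^ 2" "fps_nth f 0 = 1" "fps_nth g 0 = 1"
  shows "f = g"
proof -
  have "fps_nth (f + g) 0 \<noteq> 0"
    using assms(2,3) by simp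
  then have "f + g \<noteq> 0"
    by (metis fps_zero_nth)
  moreover have "(f - g) * (f + g) = 0"
    using assms(1) by (simp add: algebra_simps power2_eq_square)
  ultimately show ?thesis by simp
qed

lemma nth_0_s_t [simp]:
  "fps_nth s_var 0 = [:0, 1:]" "fps_nth t_var 0 = 0"
  by (simp_all add: s_var_def t_var_def)

lemma root_ser_props:
  "root_ser ^ 2 = (1 + t_var) ^ 2 - 4 * s_var * t_var"
  "fps_nth root_ser 0 = 1"
proof -
  define d :: qs_fps where "d = 2 + t_var - 4 * s_var"
  have "2 * (fps_const [:1/2:] :: qs_fps) = 1"
    by (simp add: fps_numeral_fps_const numeral_poly one_pCons)
  then obtain h :: qs_fps where h: "2 * h = 1" by blast
  obtain y :: qs_fps where "y = h * d + fps_X * (0 * y + (- h) * y ^ 2)"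
    using fps_quadratic_fixpoint by blast
  then have 2: "2 * y = d - t_var * y ^ 2"
    using h unfolding t_var_def by algebra
  have sq: "(1 + t_var * y) ^ 2 = (1 + t_var) ^ 2 - 4 * s_var * t_var"
    using 2 unfolding d_def by algebra
  have "\<exists>!r :: qs_fps. r ^ 2 = (1 + t_var) ^ 2 - 4 * s_var * t_var \<and> fps_nth r 0 = 1"
    using sq by (intro ex1I[of _ "1 + t_var * y"]) (auto intro: fps_square_eq)
  from theI'[OF this] show
    "root_ser ^ 2 = (1 + t_var) ^ 2 - 4 * s_var * t_var" "fps_nth root_ser 0 = 1"
    by (simp_all add: root_ser_def fps_sqrt_def)
qed

lemma denominators_nonzero:
  "2 * (1 - s_var) * t_var \<noteq> 0" "2 * s_var * t_var \<noteq> 0"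
proof -
  have "fps_nth (1 - s_var) 0 \<noteq> 0" "fps_nth s_var 0 \<noteq> 0"
    by (simp_all add: one_pCons)
  then have "1 - s_var \<noteq> 0" "s_var \<noteq> 0"
    by (metis fps_zero_nth)+
  then show "2 * (1 - s_var) * t_var \<noteq> 0" "2 * s_var * t_var \<noteq> 0"
    by (auto simp: t_var_def)
qed

lemma u_ser_props:
  "u_ser * (2 * (1 - s_var) * t_var) =
     1 + t_var ^ 2 - 2 * s_var * t_var - (1 - t_var) * root_ser"
  "fps_nth u_ser 0 = 0"
proof -
  obtain u :: qs_fps where
    "u = t_var * (1 - s_var) + fps_X * ((2 * s_var - t_var) * u + (1 - s_var) * u ^ 2)"
    using fps_quadratic_fixpoint by blast
  then have u:
    "u = t_var * (1 - s_var) + t_var * ((2 * s_var - t_var) * u + (1 - s_var) * u ^ 2)"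
    by (simp add: t_var_def)
  have u0: "fps_nth u 0 = 0"
    by (subst u) simp
  define p where "p = 1 + t_var ^ 2 - 2 * s_var * t_var - u * (2 * (1 - s_var) * t_var)"
  have "p ^ 2 = ((1 - t_var) * root_ser) ^ 2"
    unfolding power_mult_distrib root_ser_props(1) p_def using u by algebra
  then have "p = (1 - t_var) * root_ser"
    by (rule fps_square_eq) (simp_all add: p_def u0 root_ser_props(2) power2_eq_square)
  then have eq: "u * (2 * (1 - s_var) * t_var) =
      1 + t_var ^ 2 - 2 * s_var * t_var - (1 - t_var) * root_ser"
    unfolding p_def by algebra
  have "u_ser = u"
    unfolding u_ser_def by (rule exact_quot_eqI[OF eq denominators_nonzero(1)])
  with eq u0 show
    "u_ser * (2 * (1 - s_var) * t_var) =
       1 + t_var ^ 2 - 2 * s_var * t_var - (1 - t_var) * root_ser"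
    "fps_nth u_ser 0 = 0"
    by simp_all
qed

lemma v_ser_props:
  "v_ser * (2 * s_var * t_var) =
     (1 + t_var) ^ 2 - 2 * s_var * t_var - (1 + t_var) * root_ser"
  "fps_nth v_ser 0 = 0"
proof -
  obtain v :: qs_fps where
    "v = t_var * s_var + fps_X * ((2 * s_var - 2 - t_var) * v + s_var * v ^ 2)"
    using fps_quadratic_fixpoint by blast
  then have v:
    "v = t_var * s_var + t_var * ((2 * s_var - 2 - t_var) * v + s_var * v ^ 2)"
    by (simp add: t_var_def)
  have v0: "fps_nth v 0 = 0"
    by (subst v) simp
  define p where "p = (1 + t_var) ^ 2 - 2 * s_var * t_var - v * (2 * s_var * t_var)"
  have "p ^ 2 = ((1 + t_var) * root_ser) ^ 2"
    unfolding power_mult_distrib root_ser_props(1) p_def using v by algebra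
  then have "p = (1 + t_var) * root_ser"
    by (rule fps_square_eq) (simp_all add: p_def v0 root_ser_props(2) power2_eq_square)
  then have eq: "v * (2 * s_var * t_var) =
      (1 + t_var) ^ 2 - 2 * s_var * t_var - (1 + t_var) * root_ser"
    unfolding p_def by algebra
  have "v_ser = v"
    unfolding v_ser_def by (rule exact_quot_eqI[OF eq denominators_nonzero(2)])
  with eq v0 show
    "v_ser * (2 * s_var * t_var) =
       (1 + t_var) ^ 2 - 2 * s_var * t_var - (1 + t_var) * root_ser"
    "fps_nth v_ser 0 = 0"
    by simp_all
qed

lemma exact_quot_one_plus_uv:
  "exact_quot (1 + u_ser) (1 + u_ser * v_ser) * (1 + u_ser * v_ser) = 1 + u_ser"
proof -
  have "fps_nth (1 + u_ser * v_ser) 0 = 1"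
    by (simp add: u_ser_props(2))
  then have nz: "1 + u_ser * v_ser \<noteq> 0"
    and inv: "(1 + u_ser * v_ser) * fps_right_inverse (1 + u_ser * v_ser) 1 = 1"
    by (metis fps_zero_nth zero_neq_one, simp add: fps_right_inverse)
  have "(1 + u_ser) * fps_right_inverse (1 + u_ser * v_ser) 1 * (1 + u_ser * v_ser) =
      1 + u_ser"
    using inv by (simp add: mult.assoc mult.commute[of "fps_right_inverse _ _"])
  from exact_quot_eqI[OF this nz] this show ?thesis by simp
qed

end

theory Submission
  imports Defs
begin

text \<open>
  Inserting a new largest element into a cycle turns a double ascent or a double descent into a
  cyclic valley, or creates a double descent or a double ascent next to a peak. Hence the generating
  function of the cyclic permutations of a set, with \<open>x\<close>, \<open>y\<close>, \<open>z\<close> marking cyclic valleys, double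
  ascents and double descents, is obtained from \<open>x\<close> by iterating the derivation
  \<open>x \<mapsto> x (y + z)\<close>, \<open>y \<mapsto> x\<close>, \<open>z \<mapsto> x\<close>. This derivation preserves the polynomials in \<open>x\<close> and
  \<open>y + z\<close>, so the cyclic permutations of \<open>i \<ge> 2\<close> points contribute \<open>F\<^sub>i(st, 1 + t)\<close> with \<open>F\<^sub>i(x, q)\<close>
  homogeneous of degree \<open>i\<close> for the weights 2 and 1 of \<open>x\<close> and \<open>q\<close>. Reading a cycle as a word gives
  \<open>F\<^sub>i(t, 1 + t) = A\<^bsub>i-1\<^esub>(t)\<close>. With \<open>w = (1 + u) / (1 + uv)\<close> one has \<open>st = w\<^sup>2 v\<close> and
  \<open>1 + t = w (1 + v)\<close>, so homogeneity yields \<open>F\<^sub>i(st, 1 + t) = w\<^sup>i A\<^bsub>i-1\<^esub>(v)\<close>. Splitting off the cycle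
  of one point at a time assembles the cycles into permutations of a given type.
\<close>

section \<open>Inserting a point into a cycle\<close>

text \<open>A singleton has exactly one cyclic permutation, the identity, so fixed points count as
  cycles; the empty set has none.\<close>

definition cyclic_perms :: "'a set \<Rightarrow> ('a \<Rightarrow> 'a) set" where
  "cyclic_perms T = {\<pi>. \<pi> permutes T \<and> cyclic_on \<pi> T}"

lemma finite_cyclic_perms: "finite T \<Longrightarrow> finite (cyclic_perms T)"
  unfolding cyclic_perms_def
  by (rule finite_subset[OF _ finite_permutations[of T]]) auto

lemma orbit_of_permutes_self:
  assumes "\<pi> permutes T" "finite T"
  shows "x \<in> orbit \<pi> x"
  using assms by (intro permutation_self_in_orbit) (auto simp: permutation_permutes)

text \<open>Precomposing with the transposition makes \<open>i\<close> point to \<open>m\<close> and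
  \<open>m\<close> to the old image of \<open>i\<close>: the point \<open>m\<close> is spliced in
  right behind \<open>i\<close>. The orbit of \<open>m\<close> then follows the old orbit of
  \<open>i\<close> and closes up at \<open>m\<close>.\<close>

lemma cyclic_perms_insert:
  assumes \<pi>: "\<pi> \<in> cyclic_perms T" and i: "i \<in> T" and m: "m \<notin> T"
  shows "\<pi> \<circ> transpose i m \<in> cyclic_perms (insert m T)"
proof -
  let ?\<sigma> = "\<pi> \<circ> transpose i m"
  have perm: "\<pi> permutes T" and cyc: "cyclic_on \<pi> T"
    using \<pi> by (auto simp: cyclic_perms_def)
  have "\<pi> permutes insert m T"
    using perm by (rule permutes_subset) auto
  then have perm': "?\<sigma> permutes insert m T"
    using i by (intro permutes_compose permutes_swap_id) auto
  have [simp]: "\<pi> m = m"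
    using perm m by (auto simp: permutes_def)
  have \<sigma>_m: "\<pi> i \<in> orbit ?\<sigma> m"
    using orbit.base[of ?\<sigma> m] by (simp only: o_apply transpose_apply_second)
  have "y \<in> orbit ?\<sigma> m" if "y \<in> orbit \<pi> i" for y
    using that
  proof induction
    case base
    show ?case by (rule \<sigma>_m)
  next
    case (step y)
    then have "y \<in> T"
      using cyc i by (simp add: orbit_cyclic_eq3)
    with m have "y \<noteq> m" by auto
    show ?case
    proof (cases "y = i")
      case True
      then show ?thesis using \<sigma>_m by (simp only:)
    next
      case False
      then show ?thesis
        using orbit.step[OF step.IH] \<open>y \<noteq> m\<close> by (simp add: transpose_def)
    qed
  qed
  then have T: "T \<subseteq> orbit ?\<sigma> m"
    using cyc i by (auto simp: orbit_cyclic_eq3)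
  have "?\<sigma> i \<in> orbit ?\<sigma> m"
    using T i by (blast intro: orbit.step)
  then have "m \<in> orbit ?\<sigma> m"
    by (simp only: o_apply transpose_apply_first \<open>\<pi> m = m\<close>)
  then have "insert m T \<subseteq> orbit ?\<sigma> m"
    using T by simp
  then have "orbit ?\<sigma> m = insert m T"
    using permutes_orbit_subset[OF perm', of m] by auto
  with perm' show ?thesis
    by (auto simp: cyclic_perms_def cyclic_on_def)
qed

text \<open>The same transposition undoes the splicing: \<open>i\<close> now points past
  \<open>m\<close> to \<open>\<sigma> m\<close>, and \<open>m\<close> becomes a fixed point.\<close>

lemma cyclic_perms_remove:
  assumes \<sigma>: "\<sigma> \<in> cyclic_perms (insert m T)" and m: "m \<notin> T" and i: "i \<in> T" "\<sigma> i = m"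
  shows "\<sigma> \<circ> transpose i m \<in> cyclic_perms T"
proof -
  let ?\<pi> = "\<sigma> \<circ> transpose i m"
  have perm: "\<sigma> permutes insert m T" and cyc: "cyclic_on \<sigma> (insert m T)"
    using \<sigma> by (auto simp: cyclic_perms_def)
  have "?\<pi> permutes insert m T"
    using i perm by (intro permutes_compose permutes_swap_id) auto
  moreover have "?\<pi> x = x" if "x \<in> insert m T - T" for x
    using i that by auto
  ultimately have perm': "?\<pi> permutes T"
    by (rule permutes_superset) blast
  have \<pi>_i: "\<sigma> m \<in> orbit ?\<pi> i"
    using orbit.base[of ?\<pi> i] by (simp only: o_apply transpose_apply_first)
  \<comment> \<open>The old orbit passes through \<open>m\<close>, which the shortened cycle skips;
    the first disjunct absorbs that visit.\<close>
  have "y = m \<or> y \<in> orbit ?\<pi> i" if "y \<in> orbit \<sigma> m" for y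
    using that
  proof induction
    case base
    show ?case using \<pi>_i by blast
  next
    case (step y)
    consider "y = i" | "y = m" | "y \<noteq> i" "y \<noteq> m" by blast
    then show ?case
    proof cases
      case 3
      then have "?\<pi> y \<in> orbit ?\<pi> i"
        using step.IH by (blast intro: orbit.step)
      moreover have "?\<pi> y = \<sigma> y"
        using 3 by (simp add: transpose_def)
      ultimately show ?thesis by (simp only: simp_thms)
    qed (use i \<pi>_i in \<open>simp_all only: simp_thms\<close>)
  qed
  moreover have "orbit \<sigma> m = insert m T"
    using cyc by (simp add: orbit_cyclic_eq3)
  ultimately have "T \<subseteq> orbit ?\<pi> i"
    using m by auto
  then have "orbit ?\<pi> i = T"
    using permutes_orbit_subset[OF perm' i(1)] by auto
  with perm' i show ?thesis
    by (auto simp: cyclic_perms_def cyclic_on_def)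
qed

lemma cyclic_perms_no_fixpoint:
  assumes "\<pi> \<in> cyclic_perms T" "x \<in> T" "T \<noteq> {x}"
  shows "\<pi> x \<noteq> x"
proof
  assume "\<pi> x = x"
  then have "orbit \<pi> x = {x}"
    by (simp only: orbit_eq_singleton_iff)
  moreover have "orbit \<pi> x = T"
    using assms(1,2) by (intro orbit_cyclic_eq3) (auto simp: cyclic_perms_def)
  ultimately show False
    using assms(3) by simp
qed

text \<open>The place of insertion is recovered as the predecessor of \<open>m\<close>; it lies in
  \<open>T\<close> because a cycle on at least two points fixes none of them.\<close>

lemma bij_betw_cyclic_perms_insert:
  assumes m: "m \<notin> T" and T: "T \<noteq> {}"
  shows "bij_betw (\<lambda>(\<pi>, i). \<pi> \<circ> transpose i m) (cyclic_perms T \<times> T) (cyclic_perms (insert m T))"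
  (is "bij_betw ?f _ _")
proof (rule bij_betwI)
  let ?g = "\<lambda>\<sigma>. (\<sigma> \<circ> transpose (inv \<sigma> m) m, inv \<sigma> m)"
  show "(\<lambda>(\<pi>, i). \<pi> \<circ> transpose i m) \<in> cyclic_perms T \<times> T \<rightarrow> cyclic_perms (insert m T)"
    using m cyclic_perms_insert by fastforce
  have inv_in: "inv \<sigma> m \<in> T" "\<sigma> (inv \<sigma> m) = m" if \<sigma>: "\<sigma> \<in> cyclic_perms (insert m T)" for \<sigma>
  proof -
    have perm: "\<sigma> permutes insert m T"
      using \<sigma> by (auto simp: cyclic_perms_def)
    show *: "\<sigma> (inv \<sigma> m) = m"
      by (rule permutes_inverses[OF perm])
    have "inv \<sigma> m \<in> insert m T"
      using permutes_in_image[OF permutes_inv[OF perm]] by simp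
    moreover have "insert m T \<noteq> {m}"
      using m T by blast
    then have "\<sigma> m \<noteq> m"
      using cyclic_perms_no_fixpoint[OF \<sigma>] by blast
    with * have "inv \<sigma> m \<noteq> m" by metis
    ultimately show "inv \<sigma> m \<in> T" by simp
  qed
  show "?g \<in> cyclic_perms (insert m T) \<rightarrow> cyclic_perms T \<times> T"
    using inv_in cyclic_perms_remove[OF _ m] by blast
  show "?f (?g \<sigma>) = \<sigma>" for \<sigma>
    by (simp add: fun_eq_iff)
  show "?g (?f p) = p" if "p \<in> cyclic_perms T \<times> T" for p
  proof -
    from that obtain \<pi> i where p: "p = (\<pi>, i)" "\<pi> permutes T" "i \<in> T"
      by (auto simp: cyclic_perms_def)
    have "\<pi> m = m"
      by (rule permutes_not_in[OF p(2) m])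
    moreover have "inj (\<pi> \<circ> transpose i m)"
      using permutes_inj[OF p(2)] by (intro inj_compose) auto
    ultimately have "inv (\<pi> \<circ> transpose i m) m = i"
      by (intro inv_f_eq) simp_all
    then show ?thesis
      unfolding p(1) by (simp only: prod.case) (simp add: fun_eq_iff)
  qed
qed

lemma cyclic_perms_singleton: "cyclic_perms {x} = {id}"
  by (auto simp: cyclic_perms_def cyclic_on_def orbit_eq_singleton_iff[THEN iffD2])

text \<open>Each insertion multiplies the count by the number of places. The count later shows by
  cardinality that \<open>word_cycle\<close> is onto.\<close>

lemma card_cyclic_perms_Suc:
  assumes "finite T" "card T = Suc n"
  shows "card (cyclic_perms T) = fact n"
  using assms
proof (induction n arbitrary: T)
  case 0
  then obtain x where "T = {x}" by (auto simp: card_Suc_eq)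
  then show ?case by (simp add: cyclic_perms_singleton)
next
  case (Suc n)
  then obtain m T' where T: "T = insert m T'" "m \<notin> T'" "card T' = Suc n" "finite T'"
    by (metis card_Suc_eq_finite)
  then have "T' \<noteq> {}" by auto
  then show ?case
    using bij_betw_same_card[OF bij_betw_cyclic_perms_insert[OF T(2)]] T Suc.IH[of T']
    by (simp add: card_cartesian_product algebra_simps)
qed

lemma sum_cyclic_perms_insert:
  assumes m: "m \<notin> T" and T: "T \<noteq> {}"
  shows "(\<Sum>\<sigma>\<in>cyclic_perms (insert m T). f \<sigma>) =
    (\<Sum>\<pi>\<in>cyclic_perms T. \<Sum>i\<in>T. f (\<pi> \<circ> transpose i m))"
  by (simp add: sum.reindex_bij_betw[OF bij_betw_cyclic_perms_insert[OF assms], symmetric]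
      sum.cartesian_product split_def)

section \<open>Cyclic valleys, double ascents, double descents\<close>

text \<open>The statistics are relative to a set so that they can be taken on one cycle at a time.
  For a permutation of \<open>T\<close> without fixed points, valleys, peaks, double ascents and
  double descents partition \<open>T\<close>.\<close>

definition valleys :: "nat set \<Rightarrow> (nat \<Rightarrow> nat) \<Rightarrow> nat set" where
  "valleys T \<pi> = {j \<in> T. inv \<pi> j > j \<and> j < \<pi> j}"
definition peaks :: "nat set \<Rightarrow> (nat \<Rightarrow> nat) \<Rightarrow> nat set" where
  "peaks T \<pi> = {j \<in> T. inv \<pi> j < j \<and> j > \<pi> j}"
definition double_ascents :: "nat set \<Rightarrow> (nat \<Rightarrow> nat) \<Rightarrow> nat set" where
  "double_ascents T \<pi> = {j \<in> T. inv \<pi> j < j \<and> j < \<pi> j}"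
definition double_descents :: "nat set \<Rightarrow> (nat \<Rightarrow> nat) \<Rightarrow> nat set" where
  "double_descents T \<pi> = {j \<in> T. inv \<pi> j > j \<and> j > \<pi> j}"
definition excedances :: "nat set \<Rightarrow> (nat \<Rightarrow> nat) \<Rightarrow> nat set" where
  "excedances T \<pi> = {j \<in> T. j < \<pi> j}"

lemmas stat_defs = valleys_def peaks_def double_ascents_def double_descents_def

lemma finite_stats:
  assumes "finite T"
  shows "finite (valleys T \<pi>)" "finite (peaks T \<pi>)" "finite (double_ascents T \<pi>)"
    "finite (double_descents T \<pi>)" "finite (excedances T \<pi>)"
  using assms by (auto simp: stat_defs excedances_def)

lemma no_fixpoint_inv:
  assumes "\<pi> permutes T" "\<And>x. x \<in> T \<Longrightarrow> \<pi> x \<noteq> x" "x \<in> T"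
  shows "inv \<pi> x \<noteq> x"
  using assms by (metis permutes_inverses(1))

lemma card_excedances:
  assumes \<pi>: "\<pi> permutes T" and T: "finite T" and nf: "\<And>x. x \<in> T \<Longrightarrow> \<pi> x \<noteq> x"
  shows "card (excedances T \<pi>) = card (valleys T \<pi>) + card (double_ascents T \<pi>)"
proof -
  have "excedances T \<pi> = valleys T \<pi> \<union> double_ascents T \<pi>"
    using no_fixpoint_inv[OF \<pi> nf] by (fastforce simp: excedances_def stat_defs)
  then show ?thesis
    using finite_stats[OF T, of \<pi>] by (simp add: card_Un_disjoint disjoint_iff stat_defs)
qed

lemma image_excedances:
  assumes \<pi>: "\<pi> permutes T" and nf: "\<And>x. x \<in> T \<Longrightarrow> \<pi> x \<noteq> x"
  shows "\<pi> ` excedances T \<pi> = peaks T \<pi> \<union> double_ascents T \<pi>"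
proof -
  have "\<pi> ` excedances T \<pi> = {j \<in> T. inv \<pi> j < j}"
    using permutes_inverses[OF \<pi>] permutes_in_image[OF \<pi>] permutes_in_image[OF permutes_inv[OF \<pi>]]
    unfolding excedances_def by (auto simp: image_iff) metis
  also have "\<dots> = peaks T \<pi> \<union> double_ascents T \<pi>"
    using nf by (fastforce simp: stat_defs)
  finally show ?thesis .
qed

text \<open>Count the rises from \<open>j\<close> to \<open>\<pi> j\<close> by their lower ends,
  which are valleys and double ascents, and by their upper ends, which are peaks and double ascents;
  the double ascents cancel.\<close>

lemma card_peaks:
  assumes \<pi>: "\<pi> permutes T" and T: "finite T" and nf: "\<And>x. x \<in> T \<Longrightarrow> \<pi> x \<noteq> x"
  shows "card (peaks T \<pi>) = card (valleys T \<pi>)"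
proof -
  have "card (excedances T \<pi>) = card (\<pi> ` excedances T \<pi>)"
    by (intro card_image[symmetric] inj_on_subset[OF permutes_inj[OF \<pi>]]) auto
  also have "\<dots> = card (peaks T \<pi>) + card (double_ascents T \<pi>)"
    using finite_stats[OF T, of \<pi>]
    by (simp add: image_excedances[OF \<pi> nf] card_Un_disjoint disjoint_iff stat_defs)
  finally show ?thesis
    by (simp add: card_excedances[OF assms])
qed

section \<open>Effect of inserting a new largest point on the statistics\<close>

context
  fixes T :: "nat set" and \<pi> :: "nat \<Rightarrow> nat" and m :: nat
  assumes \<pi>: "\<pi> permutes T" and T: "finite T" and nf: "\<And>x. x \<in> T \<Longrightarrow> \<pi> x \<noteq> x"
    and m: "\<And>x. x \<in> T \<Longrightarrow> x < m"
begin

lemma insertion_apply: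
  assumes "i \<in> T" "j \<in> T"
  shows "(\<pi> \<circ> transpose i m) j = (if j = i then m else \<pi> j)"
    "inv (\<pi> \<circ> transpose i m) j = (if j = \<pi> i then m else inv \<pi> j)"
    "(\<pi> \<circ> transpose i m) m = \<pi> i" "inv (\<pi> \<circ> transpose i m) m = i"
proof -
  have mT: "m \<notin> T" using m by blast
  have [simp]: "\<pi> m = m" "inv \<pi> m = m"
    using \<pi> permutes_inv[OF \<pi>] mT by (auto simp: permutes_def)
  have jm: "j \<noteq> m" "inv \<pi> j \<noteq> m"
    using mT assms permutes_in_image[OF permutes_inv[OF \<pi>], of j] by auto
  show "(\<pi> \<circ> transpose i m) j = (if j = i then m else \<pi> j)" "(\<pi> \<circ> transpose i m) m = \<pi> i"
    using jm by (simp_all add: transpose_def)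
  have inv: "inv (\<pi> \<circ> transpose i m) = transpose i m \<circ> inv \<pi>"
    using permutes_bij[OF \<pi>] by (subst o_inv_distrib) auto
  show "inv (\<pi> \<circ> transpose i m) j = (if j = \<pi> i then m else inv \<pi> j)"
    "inv (\<pi> \<circ> transpose i m) m = i"
    unfolding inv using jm permutes_inverses[OF \<pi>] by (auto simp: transpose_def)
qed

text \<open>The point \<open>m\<close> lands between \<open>i\<close> and \<open>\<pi> i\<close> and
  is a peak, which none of the three sets records. Behind an excedance only one comparison flips:
  the predecessor of \<open>\<pi> i\<close> is now larger than it, so a double ascent there turns
  into a valley.\<close>

lemma stat_insertion_double_ascent:
  assumes i: "i \<in> excedances T \<pi>" and j: "\<pi> i \<in> double_ascents T \<pi>"
  defines "\<sigma> \<equiv> \<pi> \<circ> transpose i m"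
  shows "valleys (insert m T) \<sigma> = insert (\<pi> i) (valleys T \<pi>)"
    "double_ascents (insert m T) \<sigma> = double_ascents T \<pi> - {\<pi> i}"
    "double_descents (insert m T) \<sigma> = double_descents T \<pi>"
proof -
  have iT: "i \<in> T" "\<pi> i \<in> T" "i < \<pi> i" using i permutes_in_image[OF \<pi>] by (auto simp: excedances_def)
  note ap = insertion_apply[OF iT(1), folded \<sigma>_def]
  have j': "\<pi> i < \<pi> (\<pi> i)" "inv \<pi> (\<pi> i) = i"
    using j permutes_inverses[OF \<pi>] by (auto simp: stat_defs)
  note nfi = nf no_fixpoint_inv[OF \<pi> nf] m
  have P: "j < \<sigma> j \<longleftrightarrow> j < \<pi> j" "\<sigma> j < j \<longleftrightarrow> \<pi> j < j"
    "inv \<sigma> j < j \<longleftrightarrow> inv \<pi> j < j \<and> j \<noteq> \<pi> i" "inv \<sigma> j > j \<longleftrightarrow> inv \<pi> j > j \<or> j = \<pi> i" if "j \<in> T" for j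
    using that ap[OF that] nfi[of j] iT j' by auto
  have Q: "inv \<sigma> m < m" "\<sigma> m < m" using ap[OF iT(1)] iT m by auto
  show "valleys (insert m T) \<sigma> = insert (\<pi> i) (valleys T \<pi>)"
    "double_ascents (insert m T) \<sigma> = double_ascents T \<pi> - {\<pi> i}"
    "double_descents (insert m T) \<sigma> = double_descents T \<pi>"
    using Q iT j' by (auto simp: stat_defs P cong: conj_cong)
qed

text \<open>The same flip at a peak \<open>\<pi> i\<close>: with a larger predecessor it becomes a
  double descent.\<close>

lemma stat_insertion_peak_after:
  assumes i: "i \<in> excedances T \<pi>" and j: "\<pi> i \<in> peaks T \<pi>"
  defines "\<sigma> \<equiv> \<pi> \<circ> transpose i m"
  shows "valleys (insert m T) \<sigma> = valleys T \<pi>"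
    "double_ascents (insert m T) \<sigma> = double_ascents T \<pi>"
    "double_descents (insert m T) \<sigma> = insert (\<pi> i) (double_descents T \<pi>)"
proof -
  have iT: "i \<in> T" "\<pi> i \<in> T" "i < \<pi> i" using i permutes_in_image[OF \<pi>] by (auto simp: excedances_def)
  note ap = insertion_apply[OF iT(1), folded \<sigma>_def]
  have j': "\<pi> i > \<pi> (\<pi> i)" "inv \<pi> (\<pi> i) = i"
    using j permutes_inverses[OF \<pi>] by (auto simp: stat_defs)
  note nfi = nf no_fixpoint_inv[OF \<pi> nf] m
  have P: "j < \<sigma> j \<longleftrightarrow> j < \<pi> j" "\<sigma> j < j \<longleftrightarrow> \<pi> j < j"
    "inv \<sigma> j < j \<longleftrightarrow> inv \<pi> j < j \<and> j \<noteq> \<pi> i" "inv \<sigma> j > j \<longleftrightarrow> inv \<pi> j > j \<or> j = \<pi> i" if "j \<in> T" for j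
    using that ap[OF that] nfi[of j] iT j' by auto
  have Q: "inv \<sigma> m < m" "\<sigma> m < m" using ap[OF iT(1)] iT m by auto
  show "valleys (insert m T) \<sigma> = valleys T \<pi>"
    "double_ascents (insert m T) \<sigma> = double_ascents T \<pi>"
    "double_descents (insert m T) \<sigma> = insert (\<pi> i) (double_descents T \<pi>)"
    using Q iT j' by (auto simp: stat_defs P cong: conj_cong)
qed

text \<open>Behind a point with a smaller image the only flip is at \<open>i\<close>, whose
  successor \<open>m\<close> is now larger. Since \<open>i\<close> keeps its larger predecessor, it
  becomes a valley.\<close>

lemma stat_insertion_double_descent:
  assumes i: "i \<in> double_descents T \<pi>"
  defines "\<sigma> \<equiv> \<pi> \<circ> transpose i m"
  shows "valleys (insert m T) \<sigma> = insert i (valleys T \<pi>)"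
    "double_ascents (insert m T) \<sigma> = double_ascents T \<pi>"
    "double_descents (insert m T) \<sigma> = double_descents T \<pi> - {i}"
proof -
  have iT: "i \<in> T" "\<pi> i \<in> T" "i > \<pi> i" "i < inv \<pi> i" using i permutes_in_image[OF \<pi>] by (auto simp: stat_defs)
  note ap = insertion_apply[OF iT(1), folded \<sigma>_def]
  have j': "inv \<pi> (\<pi> i) = i"
    using permutes_inverses[OF \<pi>] by auto
  note nfi = nf no_fixpoint_inv[OF \<pi> nf] m
  have P: "j < \<sigma> j \<longleftrightarrow> j < \<pi> j \<or> j = i" "\<sigma> j < j \<longleftrightarrow> \<pi> j < j \<and> j \<noteq> i"
    "inv \<sigma> j < j \<longleftrightarrow> inv \<pi> j < j" "inv \<sigma> j > j \<longleftrightarrow> inv \<pi> j > j" if "j \<in> T" for j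
    using that ap[OF that] nfi[of j] iT j' by auto
  have Q: "inv \<sigma> m < m" "\<sigma> m < m" using ap[OF iT(1)] iT m by auto
  show "valleys (insert m T) \<sigma> = insert i (valleys T \<pi>)"
    "double_ascents (insert m T) \<sigma> = double_ascents T \<pi>"
    "double_descents (insert m T) \<sigma> = double_descents T \<pi> - {i}"
    using Q iT j' by (auto simp: stat_defs P cong: conj_cong)
qed

text \<open>Again only the successor of \<open>i\<close> changes sides; the predecessor stays
  smaller, so the peak becomes a double ascent.\<close>

lemma stat_insertion_peak_before:
  assumes i: "i \<in> peaks T \<pi>"
  defines "\<sigma> \<equiv> \<pi> \<circ> transpose i m"
  shows "valleys (insert m T) \<sigma> = valleys T \<pi>"
    "double_ascents (insert m T) \<sigma> = insert i (double_ascents T \<pi>)"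
    "double_descents (insert m T) \<sigma> = double_descents T \<pi>"
proof -
  have iT: "i \<in> T" "\<pi> i \<in> T" "i > \<pi> i" "i > inv \<pi> i" using i permutes_in_image[OF \<pi>] by (auto simp: stat_defs)
  note ap = insertion_apply[OF iT(1), folded \<sigma>_def]
  have j': "inv \<pi> (\<pi> i) = i"
    using permutes_inverses[OF \<pi>] by auto
  note nfi = nf no_fixpoint_inv[OF \<pi> nf] m
  have P: "j < \<sigma> j \<longleftrightarrow> j < \<pi> j \<or> j = i" "\<sigma> j < j \<longleftrightarrow> \<pi> j < j \<and> j \<noteq> i"
    "inv \<sigma> j < j \<longleftrightarrow> inv \<pi> j < j" "inv \<sigma> j > j \<longleftrightarrow> inv \<pi> j > j" if "j \<in> T" for j
    using that ap[OF that] nfi[of j] iT j' by auto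
  have Q: "inv \<sigma> m < m" "\<sigma> m < m" using ap[OF iT(1)] iT m by auto
  show "valleys (insert m T) \<sigma> = valleys T \<pi>"
    "double_ascents (insert m T) \<sigma> = insert i (double_ascents T \<pi>)"
    "double_descents (insert m T) \<sigma> = double_descents T \<pi>"
    using Q iT j' by (auto simp: stat_defs P cong: conj_cong)
qed

end

text \<open>The derivation, expressed through the values \<open>g k a d\<close> that a linear functional takes on the
  monomials \<open>x\<^sup>k y\<^sup>a z\<^sup>d\<close>.\<close>

definition insertion_op ::
    "(nat \<Rightarrow> nat \<Rightarrow> nat \<Rightarrow> 'a::comm_semiring_1) \<Rightarrow> nat \<Rightarrow> nat \<Rightarrow> nat \<Rightarrow> 'a" where
  "insertion_op g k a d =
     of_nat a * g (k + 1) (a - 1) d + of_nat k * g k a (d + 1) +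
     of_nat d * g (k + 1) a (d - 1) + of_nat k * g k (a + 1) d"

definition stat_sum :: "nat set \<Rightarrow> (nat \<Rightarrow> nat \<Rightarrow> nat \<Rightarrow> 'a::comm_semiring_1) \<Rightarrow> 'a" where
  "stat_sum T g = (\<Sum>\<pi>\<in>cyclic_perms T.
     g (card (valleys T \<pi>)) (card (double_ascents T \<pi>)) (card (double_descents T \<pi>)))"

text \<open>The terms of \<open>insertion_op\<close> come from four kinds of places: excedances
  whose image is a double ascent or a peak, double descents, and peaks. Both peak terms carry the
  factor \<open>k\<close> because there are as many peaks as valleys.\<close>

lemma sum_over_insertions:
  fixes g :: "nat \<Rightarrow> nat \<Rightarrow> nat \<Rightarrow> 'a::comm_semiring_1"
  assumes \<pi>: "\<pi> permutes T" and T: "finite T" and nf: "\<And>x. x \<in> T \<Longrightarrow> \<pi> x \<noteq> x"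
    and m: "\<And>x. x \<in> T \<Longrightarrow> x < m"
  defines "G \<equiv> \<lambda>i. g (card (valleys (insert m T) (\<pi> \<circ> transpose i m)))
      (card (double_ascents (insert m T) (\<pi> \<circ> transpose i m)))
      (card (double_descents (insert m T) (\<pi> \<circ> transpose i m)))"
  shows "(\<Sum>i\<in>T. G i) = insertion_op g (card (valleys T \<pi>)) (card (double_ascents T \<pi>))
      (card (double_descents T \<pi>))"
proof -
  let ?V = "valleys T \<pi>" and ?P = "peaks T \<pi>" and ?A = "double_ascents T \<pi>"
    and ?D = "double_descents T \<pi>" and ?E = "excedances T \<pi>"
  note fin = finite_stats[OF T, of \<pi>]
  note ins = stat_insertion_double_ascent[OF \<pi> T nf m] stat_insertion_peak_after[OF \<pi> T nf m]
    stat_insertion_double_descent[OF \<pi> T nf m] stat_insertion_peak_before[OF \<pi> T nf m]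
  have inj: "inj_on \<pi> ?E"
    using permutes_inj[OF \<pi>] by (rule inj_on_subset) simp
  let ?G1 = "g (card ?V + 1) (card ?A - 1) (card ?D)" and ?G2 = "g (card ?V) (card ?A) (card ?D + 1)"
  have T_eq: "T = ?E \<union> (?D \<union> ?P)" "?E \<inter> (?D \<union> ?P) = {}" "?D \<inter> ?P = {}"
    using nf no_fixpoint_inv[OF \<pi> nf] by (fastforce simp: stat_defs excedances_def)+
  have img: "\<pi> ` ?E = ?P \<union> ?A"
    by (rule image_excedances[OF \<pi> nf])
  have disj: "?A \<inter> ?V = {}" "?D \<inter> ?V = {}" "?A \<inter> ?P = {}" "?D \<inter> ?P = {}"
    by (auto simp: stat_defs)
  \<comment> \<open>For an excedance the outcome depends on \<open>\<pi> i\<close>, so the sum is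
    transported along \<open>\<pi>\<close> to the peaks and double ascents.\<close>
  have "(\<Sum>i\<in>?E. G i) = (\<Sum>i\<in>?E. if \<pi> i \<in> ?A then ?G1 else ?G2)"
  proof (rule sum.cong)
    fix i assume i: "i \<in> ?E"
    then have "\<pi> i \<in> ?P \<union> ?A"
      using img by blast
    moreover have "\<pi> i \<notin> ?V" if "\<pi> i \<in> ?A" using that disj by blast
    moreover have "\<pi> i \<notin> ?D \<and> \<pi> i \<notin> ?A" if "\<pi> i \<in> ?P" using that disj by blast
    ultimately show "G i = (if \<pi> i \<in> ?A then ?G1 else ?G2)"
      using i fin by (auto simp: G_def ins card_insert_if card_Diff_singleton)
  qed simp
  also have "\<dots> = (\<Sum>j\<in>\<pi> ` ?E. if j \<in> ?A then ?G1 else ?G2)"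
    using inj by (simp add: sum.reindex)
  also have "\<dots> = (\<Sum>j\<in>?A. if j \<in> ?A then ?G1 else ?G2) + (\<Sum>j\<in>?P. if j \<in> ?A then ?G1 else ?G2)"
    unfolding img using fin disj
    by (subst sum.union_disjoint) (auto simp: add.commute)
  also have "(\<Sum>j\<in>?P. if j \<in> ?A then ?G1 else ?G2) = (\<Sum>j\<in>?P. ?G2)"
    using disj by (intro sum.cong) auto
  also have "(\<Sum>j\<in>?A. if j \<in> ?A then ?G1 else ?G2) + (\<Sum>j\<in>?P. ?G2) =
      of_nat (card ?A) * ?G1 + of_nat (card ?P) * ?G2"
    by simp
  finally have E: "(\<Sum>i\<in>?E. G i) = of_nat (card ?A) * ?G1 + of_nat (card ?P) * ?G2" .
  have D: "(\<Sum>i\<in>?D. G i) = of_nat (card ?D) * g (card ?V + 1) (card ?A) (card ?D - 1)"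
  proof -
    have "G i = g (card ?V + 1) (card ?A) (card ?D - 1)" if i: "i \<in> ?D" for i
    proof -
      have "i \<notin> ?V" using i disj by blast
      then show ?thesis using i fin by (simp add: G_def ins card_insert_if card_Diff_singleton)
    qed
    then show ?thesis by simp
  qed
  have P: "(\<Sum>i\<in>?P. G i) = of_nat (card ?P) * g (card ?V) (card ?A + 1) (card ?D)"
  proof -
    have "G i = g (card ?V) (card ?A + 1) (card ?D)" if i: "i \<in> ?P" for i
    proof -
      have "i \<notin> ?A" using i disj by blast
      then show ?thesis using i fin by (simp add: G_def ins card_insert_if)
    qed
    then show ?thesis by simp
  qed
  have "(\<Sum>i\<in>T. G i) = (\<Sum>i\<in>?E. G i) + ((\<Sum>i\<in>?D. G i) + (\<Sum>i\<in>?P. G i))"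
    using fin T_eq by (metis sum.union_disjoint finite_UnI)
  then show ?thesis
    by (simp add: E D P card_peaks[OF \<pi> T nf] insertion_op_def add.assoc)
qed

section \<open>Iterated insertion, starting from two points\<close>

lemma stat_sum_insert:
  assumes T: "finite T" "card T \<ge> 2" and m: "\<And>x. x \<in> T \<Longrightarrow> x < m"
  shows "stat_sum (insert m T) g = stat_sum T (insertion_op g)"
proof -
  have "m \<notin> T" "T \<noteq> {}" using T m by auto
  then have "stat_sum (insert m T) g = (\<Sum>\<pi>\<in>cyclic_perms T. \<Sum>i\<in>T.
      g (card (valleys (insert m T) (\<pi> \<circ> transpose i m)))
      (card (double_ascents (insert m T) (\<pi> \<circ> transpose i m)))
      (card (double_descents (insert m T) (\<pi> \<circ> transpose i m))))"
    unfolding stat_sum_def by (rule sum_cyclic_perms_insert)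
  also have "\<dots> = stat_sum T (insertion_op g)"
    unfolding stat_sum_def
  proof (rule sum.cong[OF refl])
    fix \<pi> assume \<pi>: "\<pi> \<in> cyclic_perms T"
    have "\<pi> x \<noteq> x" if "x \<in> T" for x
      using \<pi> that T by (intro cyclic_perms_no_fixpoint[of \<pi> T]) auto
    then show "(\<Sum>i\<in>T. g (card (valleys (insert m T) (\<pi> \<circ> transpose i m)))
      (card (double_ascents (insert m T) (\<pi> \<circ> transpose i m)))
      (card (double_descents (insert m T) (\<pi> \<circ> transpose i m)))) =
      insertion_op g (card (valleys T \<pi>)) (card (double_ascents T \<pi>)) (card (double_descents T \<pi>))"
      using \<pi> T m by (intro sum_over_insertions) (auto simp: cyclic_perms_def)
  qed
  finally show ?thesis .
qed

text \<open>The transposition has one valley and one peak, which is the monomial \<open>x\<close>.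
  The iteration starts at two points because a single point is fixed and falls into none of the
  classes.\<close>

lemma stat_sum_pair:
  assumes "a < b"
  shows "stat_sum {b, a} g = g 1 0 0"
proof -
  have inv: "inv (transpose a b) = transpose a b"
    by (rule inv_unique_comp) (auto simp: fun_eq_iff)
  have "valleys {b, a} (transpose a b) = {a}" "double_ascents {b, a} (transpose a b) = {}"
    "double_descents {b, a} (transpose a b) = {}"
    using assms by (auto simp: stat_defs inv)
  then show ?thesis
    using assms unfolding stat_sum_def
    by (subst sum_cyclic_perms_insert) (auto simp: cyclic_perms_singleton)
qed

text \<open>Peeling off maxima leaves a pair, so only the cardinality matters. As
  \<open>insertion_op\<close> acts on functionals, the operator of the point inserted last is
  applied to \<open>g\<close> first.\<close>

lemma stat_sum_card:
  assumes "finite T" "card T = n + 2"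
  shows "stat_sum T g = (insertion_op ^^ n) g 1 0 0"
  using assms
proof (induction n arbitrary: T g)
  case (0 T g)
  then have "card T = 2" by simp
  then obtain x y where xy: "T = {x, y}" "x \<noteq> y"
    unfolding card_2_iff by blast
  show ?case
  proof (cases "x < y")
    case True
    then show ?thesis using stat_sum_pair[of x y g] xy by (simp add: insert_commute)
  next
    case False
    then show ?thesis using stat_sum_pair[of y x g] xy by simp
  qed
next
  case (Suc n T g)
  define m where "m = Max T"
  have "T \<noteq> {}" using Suc.prems by auto
  then have m: "m \<in> T" "\<And>x. x \<in> T - {m} \<Longrightarrow> x < m"
    using Suc.prems(1) by (auto simp: m_def less_le)
  have "stat_sum (insert m (T - {m})) g = stat_sum (T - {m}) (insertion_op g)"
    using Suc.prems m by (intro stat_sum_insert) auto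
  also have "\<dots> = (insertion_op ^^ n) (insertion_op g) 1 0 0"
    using Suc.prems m by (intro Suc.IH) auto
  finally show ?case
    using m by (simp add: insert_absorb funpow_swap1)
qed

text \<open>The \<open>n\<close>-th derivative of \<open>x\<^sup>k q\<^sup>r\<close>, where \<open>q = y + z\<close> has derivative \<open>2x\<close>.\<close>

fun gamma_poly :: "nat \<Rightarrow> nat \<Rightarrow> nat \<Rightarrow> 'a::comm_semiring_1 \<Rightarrow> 'a \<Rightarrow> 'a" where
  "gamma_poly 0 k r x q = x ^ k * q ^ r"
| "gamma_poly (Suc n) k r x q =
     of_nat k * gamma_poly n k (r + 1) x q + of_nat (2 * r) * gamma_poly n (k + 1) (r - 1) x q"

text \<open>With weight 2 for \<open>x\<close> and 1 for \<open>q\<close>, each derivation raises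
  the weight of \<open>x ^ k * q ^ r\<close> by one.\<close>

lemma gamma_poly_homogeneous:
  "gamma_poly n k r (w ^ 2 * x) (w * q) = w ^ (2 * k + r + n) * gamma_poly n k r x q"
proof (induction n arbitrary: k r)
  case 0
  then show ?case
    by (simp add: power_mult_distrib power_mult[symmetric] power_add algebra_simps)
next
  case (Suc n)
  \<comment> \<open>At \<open>r = 0\<close> the truncated \<open>r - 1\<close> would spoil the
    weight, but that term has coefficient 0.\<close>
  then show ?case
    by (cases r) (simp_all add: algebra_simps)
qed

text \<open>The value of the functional \<open>g\<close> on the polynomial
  \<open>x ^ k * (y + z) ^ r\<close>.\<close>

definition binomial_sum :: "(nat \<Rightarrow> nat \<Rightarrow> nat \<Rightarrow> 'a::comm_semiring_1) \<Rightarrow> nat \<Rightarrow> nat \<Rightarrow> 'a" where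
  "binomial_sum g k r = (\<Sum>j\<le>r. of_nat (r choose j) * g k j (r - j))"

text \<open>Pascal's rule: one factor \<open>y + z\<close> is split off.\<close>

lemma binomial_sum_Suc:
  "binomial_sum g k (Suc r) =
    (\<Sum>j\<le>r. of_nat (r choose j) * (g k (Suc j) (r - j) + g k j (Suc r - j)))"
proof -
  have "binomial_sum g k (Suc r) =
     g k 0 (Suc r) + (\<Sum>j\<le>r. of_nat (Suc r choose Suc j) * g k (Suc j) (r - j))"
    unfolding binomial_sum_def by (subst sum.atMost_Suc_shift) simp
  also have "\<dots> = (g k 0 (Suc r) + (\<Sum>j\<le>r. of_nat (r choose Suc j) * g k (Suc j) (r - j))) +
     (\<Sum>j\<le>r. of_nat (r choose j) * g k (Suc j) (r - j))"
    by (simp add: algebra_simps sum.distrib)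
  also have "g k 0 (Suc r) + (\<Sum>j\<le>r. of_nat (r choose Suc j) * g k (Suc j) (r - j)) =
     (\<Sum>j\<le>Suc r. of_nat (r choose j) * g k j (Suc r - j))"
    by (subst sum.atMost_Suc_shift) simp
  also have "\<dots> = (\<Sum>j\<le>r. of_nat (r choose j) * g k j (Suc r - j))"
    by (simp add: binomial_eq_0)
  finally show ?thesis
    by (simp add: algebra_simps sum.distrib)
qed

text \<open>The partial derivative of \<open>(y + z) ^ r\<close> in \<open>y\<close>, by absorbing
  \<open>j\<close> into the binomial coefficient.\<close>

lemma binomial_sum_ascents:
  "(\<Sum>j\<le>r. of_nat (r choose j) * (of_nat j * g k (j - 1) (r - j))) =
    of_nat r * binomial_sum g k (r - 1)"
proof (cases r)
  case (Suc r')
  have "(\<Sum>j\<le>r. of_nat (r choose j) * (of_nat j * g k (j - 1) (r - j))) =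
    (\<Sum>j\<le>r'. of_nat ((Suc r' choose Suc j) * Suc j) * g k j (r' - j))"
    unfolding Suc by (subst sum.atMost_Suc_shift) (simp add: mult.assoc del: binomial_Suc_Suc of_nat_Suc mult_Suc_right)
  also have "\<dots> = (\<Sum>j\<le>r'. of_nat (Suc r' * (r' choose j)) * g k j (r' - j))"
    by (intro sum.cong refl, simp only: Suc_times_binomial mult.commute[of "Suc r' choose _"])
  also have "\<dots> = of_nat r * binomial_sum g k (r - 1)"
    unfolding Suc binomial_sum_def sum_distrib_left
    by (simp only: of_nat_mult mult.assoc diff_Suc_1)
  finally show ?thesis .
qed simp

lemma binomial_sum_swap: "binomial_sum (\<lambda>k a d. g k (r - a) a) k r = binomial_sum g k r"
  unfolding binomial_sum_def
  by (rule sum.reindex_bij_witness[of _ "\<lambda>j. r - j" "\<lambda>j. r - j"])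
    (auto simp: binomial_symmetric[symmetric])

lemma binomial_sum_descents:
  "(\<Sum>j\<le>r. of_nat (r choose j) * (of_nat (r - j) * g k j (r - j - 1))) =
    of_nat r * binomial_sum g k (r - 1)"
proof -
  have "(\<Sum>j\<le>r. of_nat (r choose j) * (of_nat (r - j) * g k j (r - j - 1))) =
    (\<Sum>j\<le>r. of_nat (r choose j) * (of_nat j * g k (r - j) (j - 1)))"
    by (rule sum.reindex_bij_witness[of _ "\<lambda>j. r - j" "\<lambda>j. r - j"])
      (auto simp: binomial_symmetric[symmetric])
  \<comment> \<open>After exchanging \<open>y\<close> and \<open>z\<close>, the argument
    \<open>r - j\<close> is rewritten to fit the previous case; at \<open>j = 0\<close> the two
    forms differ, but the factor \<open>j\<close> vanishes.\<close>
  also have "\<dots> = (\<Sum>j\<le>r. of_nat (r choose j) * (of_nat j * g k (r - 1 - (j - 1)) (j - 1)))"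
    by (rule sum.cong) (auto simp: Suc_diff_le split: nat_diff_split)
  also have "\<dots> = of_nat r * binomial_sum (\<lambda>k a d. g k (r - 1 - a) a) k (r - 1)"
    by (rule binomial_sum_ascents[of r "\<lambda>k a d. g k (r - 1 - a) a"])
  also have "binomial_sum (\<lambda>k a d. g k (r - 1 - a) a) k (r - 1) = binomial_sum g k (r - 1)"
    by (rule binomial_sum_swap)
  finally show ?thesis .
qed

text \<open>The derivation stays within polynomials in \<open>x\<close> and
  \<open>q = y + z\<close>: the terms with factor \<open>k\<close> combine to one more factor
  \<open>q\<close>, and the derivatives in \<open>y\<close> and \<open>z\<close> contribute
  \<open>r\<close> each.\<close>

lemma binomial_sum_insertion_op:
  "binomial_sum (insertion_op g) k r =
    of_nat k * binomial_sum g k (r + 1) + of_nat (2 * r) * binomial_sum g (k + 1) (r - 1)"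
proof -
  have "binomial_sum (insertion_op g) k r =
    of_nat k * (\<Sum>j\<le>r. of_nat (r choose j) * (g k (Suc j) (r - j) + g k j (Suc r - j))) +
    (\<Sum>j\<le>r. of_nat (r choose j) * (of_nat j * g (k + 1) (j - 1) (r - j))) +
    (\<Sum>j\<le>r. of_nat (r choose j) * (of_nat (r - j) * g (k + 1) j (r - j - 1)))"
    unfolding binomial_sum_def insertion_op_def sum_distrib_left sum.distrib[symmetric]
    by (rule sum.cong) (auto simp: algebra_simps Suc_diff_le)
  also have "\<dots> = of_nat k * binomial_sum g k (r + 1) + of_nat (2 * r) * binomial_sum g (k + 1) (r - 1)"
    by (simp only: binomial_sum_ascents binomial_sum_descents binomial_sum_Suc Suc_eq_plus1[symmetric])
      (simp add: algebra_simps mult_2)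
  finally show ?thesis .
qed

lemma binomial_sum_insertion_op_funpow:
  "binomial_sum ((insertion_op ^^ n) (\<lambda>k a d. x ^ k * y ^ a * z ^ d)) k r = gamma_poly n k r x (y + z)"
proof (induction n arbitrary: k r)
  case 0
  then show ?case
    by (simp add: binomial_sum_def binomial_ring sum_distrib_left mult_ac)
next
  case (Suc n)
  then show ?case by (simp add: binomial_sum_insertion_op)
qed

lemma stat_sum_monomial:
  fixes x y z :: "'a::comm_semiring_1"
  assumes "finite T" "card T = n + 2"
  shows "stat_sum T (\<lambda>k a d. x ^ k * y ^ a * z ^ d) = gamma_poly n 1 0 x (y + z)"
proof -
  have "stat_sum T (\<lambda>k a d. x ^ k * y ^ a * z ^ d) =
      binomial_sum ((insertion_op ^^ n) (\<lambda>k a d. x ^ k * y ^ a * z ^ d)) 1 0"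
    by (simp add: stat_sum_card[OF assms] binomial_sum_def)
  then show ?thesis by (simp only: binomial_sum_insertion_op_funpow)
qed

section \<open>Eulerian polynomials\<close>

text \<open>The cycle \<open>1 \<mapsto> m \<mapsto> m - 1 \<mapsto> \<dots> \<mapsto> 1\<close>,
  the model that is conjugated to obtain the cycle of a word.\<close>

definition down_cycle :: "nat \<Rightarrow> nat \<Rightarrow> nat" where
  "down_cycle m j = (if j = 1 then m else if 1 < j \<and> j \<le> m then j - 1 else j)"

lemma down_cycle_permutes:
  assumes "m \<ge> 1"
  shows "down_cycle m permutes {1..m}"
proof (rule bij_imp_permutes)
  have "inj_on (down_cycle m) {1..m}"
    by (auto simp: inj_on_def down_cycle_def split: if_splits)
  moreover have "down_cycle m ` {1..m} \<subseteq> {1..m}"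
    using assms by (auto simp: down_cycle_def)
  ultimately show "bij_betw (down_cycle m) {1..m} {1..m}"
    by (simp add: bij_betw_def endo_inj_surj)
qed (use assms in \<open>auto simp: down_cycle_def\<close>)

lemma cyclic_on_down_cycle:
  assumes "m \<ge> 1"
  shows "cyclic_on (down_cycle m) {1..m}"
proof -
  have "m - k \<in> orbit (down_cycle m) 1" if "k < m" for k
    using that
  proof (induction k)
    case 0
    have "down_cycle m 1 = m - 0"
      by (simp add: down_cycle_def)
    then show ?case
      using orbit.base[of "down_cycle m" 1] by metis
  next
    case (Suc k)
    then have "down_cycle m (m - k) \<in> orbit (down_cycle m) 1"
      by (intro orbit.step) auto
    moreover have "down_cycle m (m - k) = m - Suc k"
      using Suc.prems by (simp add: down_cycle_def)
    ultimately show ?case by (simp only:)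
  qed
  from this[of "m - j" for j] have "j \<in> orbit (down_cycle m) 1" if "j \<in> {1..m}" for j
    using that by (metis atLeastAtMost_iff diff_diff_cancel diff_less less_eq_Suc_le One_nat_def
        order_less_le_trans)
  then have "{1..m} = orbit (down_cycle m) 1"
    using permutes_orbit_subset[OF down_cycle_permutes[OF assms], of 1] assms by auto
  with assms show ?thesis
    by (auto simp: cyclic_on_def)
qed

text \<open>The cycle \<open>m + 1 \<mapsto> \<pi> m \<mapsto> \<dots> \<mapsto> \<pi> 1 \<mapsto> m + 1\<close>. Its excedances are \<open>\<pi> 1\<close> and the bottoms of the
  descents of \<open>\<pi>\<close>.\<close>

definition word_cycle :: "nat \<Rightarrow> (nat \<Rightarrow> nat) \<Rightarrow> nat \<Rightarrow> nat" where
  "word_cycle m \<pi> = \<pi> \<circ> down_cycle (Suc m) \<circ> inv \<pi>"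

context
  fixes m :: nat and \<pi> :: "nat \<Rightarrow> nat"
  assumes \<pi>: "\<pi> permutes {1..m}"
begin

lemma permutes_Suc: "\<pi> permutes {1..Suc m}"
  using \<pi> by (rule permutes_subset) auto

lemma word_cycle_apply: "word_cycle m \<pi> (\<pi> j) = \<pi> (down_cycle (Suc m) j)"
  using permutes_inverses[OF \<pi>] by (simp add: word_cycle_def)

lemma word_cycle_in_cyclic_perms: "word_cycle m \<pi> \<in> cyclic_perms {1..Suc m}"
proof -
  have "word_cycle m \<pi> permutes {1..Suc m}"
    unfolding word_cycle_def
    by (intro permutes_compose permutes_inv permutes_Suc down_cycle_permutes) simp
  moreover have "cyclic_on (word_cycle m \<pi>) (\<pi> ` {1..Suc m})"
    by (rule cyclic_on_image[OF cyclic_on_down_cycle]) (simp_all add: word_cycle_apply)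
  ultimately show ?thesis
    by (simp only: cyclic_perms_def permutes_image[OF permutes_Suc] mem_Collect_eq simp_thms)
qed

lemma card_excedances_word_cycle:
  assumes "m \<ge> 1"
  shows "card (excedances {1..Suc m} (word_cycle m \<pi>)) = des m \<pi> + 1"
proof -
  let ?J = "{j \<in> {1..Suc m}. \<pi> j < \<pi> (down_cycle (Suc m) j)}"
  let ?D = "{i \<in> {1..<m}. \<pi> i > \<pi> (i + 1)}"
  have \<pi>_m: "\<pi> (Suc m) = Suc m"
    by (rule permutes_not_in[OF \<pi>]) simp
  have range: "\<pi> j \<le> m" if "1 \<le> j" "j \<le> m" for j
    using permutes_in_image[OF \<pi>, of j] that by simp
  have "excedances {1..Suc m} (word_cycle m \<pi>) = \<pi> ` ?J"
  proof -
    have "{1..Suc m} = \<pi> ` {1..Suc m}"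
      by (rule permutes_image[OF permutes_Suc, symmetric])
    then have "excedances {1..Suc m} (word_cycle m \<pi>) =
        {i \<in> \<pi> ` {1..Suc m}. i < word_cycle m \<pi> i}"
      by (simp add: excedances_def)
    then show ?thesis by (auto simp: word_cycle_apply)
  qed
  also have "card (\<pi> ` ?J) = card ?J"
    by (intro card_image inj_on_subset[OF permutes_inj[OF \<pi>]]) simp
  \<comment> \<open>Index 1 always counts, as its successor is \<open>\<pi> (Suc m) = Suc m\<close>;
    index \<open>Suc m\<close> never counts, as it carries the maximum. The others are descents
    shifted by one.\<close>
  also have "?J = insert 1 (Suc ` ?D)"
  proof (rule set_eqI)
    fix j
    consider "j = 0" | "j = 1" | i where "j = Suc i" "i \<ge> 1" "i \<le> m" | "j > Suc m"
      by (metis One_nat_def not_less_eq_eq not0_implies_Suc le_less_linear le_0_eq le_simps(3))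
    then show "j \<in> ?J \<longleftrightarrow> j \<in> insert 1 (Suc ` ?D)"
    proof cases
      case 2
      then show ?thesis
        using \<pi>_m range[of 1] assms by (simp add: down_cycle_def)
    next
      case 3
      then show ?thesis
        using \<pi>_m range[of m] by (cases "i = m") (auto simp: down_cycle_def)
    qed auto
  qed
  also have "card (insert 1 (Suc ` ?D)) = des m \<pi> + 1"
    by (subst card_insert_disjoint) (auto simp: card_image des_def)
  finally show ?thesis .
qed

end

text \<open>The value at \<open>Suc m\<close> is known, so walking along the cycle from there reads
  off the word; this anchor removes the ambiguity of rotations.\<close>

lemma word_cycle_inj: "inj_on (word_cycle m) {\<pi>. \<pi> permutes {1..m}}"
proof (rule inj_onI, clarify)
  fix \<pi> \<rho> assume \<pi>: "\<pi> permutes {1..m}" and \<rho>: "\<rho> permutes {1..m}"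
    and eq: "word_cycle m \<pi> = word_cycle m \<rho>"
  have out: "\<pi> j = \<rho> j" if "j \<notin> {1..m}" for j
    using permutes_not_in[OF \<pi> that] permutes_not_in[OF \<rho> that] by simp
  have "\<pi> (Suc m - k) = \<rho> (Suc m - k)" if "k \<le> m" for k
    using that
  proof (induction k)
    case 0
    then show ?case by (simp add: out)
  next
    case (Suc k)
    have "\<pi> (down_cycle (Suc m) (Suc m - k)) = \<rho> (down_cycle (Suc m) (Suc m - k))"
      using Suc eq word_cycle_apply[OF \<pi>, of "Suc m - k"] word_cycle_apply[OF \<rho>, of "Suc m - k"]
      by simp
    moreover have "down_cycle (Suc m) (Suc m - k) = Suc m - Suc k"
      using Suc.prems by (auto simp: down_cycle_def)
    ultimately show ?case by simp
  qed
  note this[of "Suc m - j" for j]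
  then have "\<pi> j = \<rho> j" if "j \<in> {1..m}" for j
    using that by (metis One_nat_def Suc_diff_le Suc_leI Suc_le_mono atLeastAtMost_iff
        diff_diff_cancel diff_le_self le_SucI not_less_eq_eq diff_Suc_Suc diff_le_mono2 diff_Suc_1)
  with out show "\<pi> = \<rho>" by blast
qed

lemma word_cycle_bij:
  "bij_betw (word_cycle m) {\<pi>. \<pi> permutes {1..m}} (cyclic_perms {1..Suc m})"
proof -
  have "word_cycle m ` {\<pi>. \<pi> permutes {1..m}} = cyclic_perms {1..Suc m}"
  proof (rule card_subset_eq)
    show "word_cycle m ` {\<pi>. \<pi> permutes {1..m}} \<subseteq> cyclic_perms {1..Suc m}"
      using word_cycle_in_cyclic_perms by blast
    show "card (word_cycle m ` {\<pi>. \<pi> permutes {1..m}}) = card (cyclic_perms {1..Suc m})"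
      unfolding card_image[OF word_cycle_inj]
      by (simp add: card_permutations card_cyclic_perms_Suc[where n = m])
  qed (simp add: finite_cyclic_perms)
  then show ?thesis
    using word_cycle_inj by (simp only: bij_betw_def simp_thms)
qed

lemma card_excedances_cyclic:
  assumes "\<pi> \<in> cyclic_perms T" "finite T" "card T \<ge> 2"
  shows "card (excedances T \<pi>) = card (valleys T \<pi>) + card (double_ascents T \<pi>)"
proof (rule card_excedances)
  show "\<pi> x \<noteq> x" if "x \<in> T" for x
    using assms that by (intro cyclic_perms_no_fixpoint[of \<pi> T]) auto
qed (use assms in \<open>auto simp: cyclic_perms_def\<close>)

text \<open>Words of \<open>n + 1\<close> letters become cycles on \<open>n + 2\<close> points.
  Valleys and double ascents are the excedances, hence \<open>x = y = t\<close> and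
  \<open>z = 1\<close>.\<close>

lemma poly_eulerian_eq_gamma_poly:
  fixes t :: "'a::comm_semiring_1"
  shows "poly (eulerian_poly (Suc n)) t = gamma_poly n 1 0 t (1 + t)"
proof -
  let ?T = "{1..Suc (Suc n)}"
  have "poly (eulerian_poly (Suc n)) t = (\<Sum>\<pi> | \<pi> permutes {1..Suc n}. t ^ (des (Suc n) \<pi> + 1))"
    by (simp add: eulerian_poly_def poly_sum poly_monom)
  also have "\<dots> = (\<Sum>\<pi> | \<pi> permutes {1..Suc n}. t ^ card (excedances ?T (word_cycle (Suc n) \<pi>)))"
    by (intro sum.cong refl) (simp add: card_excedances_word_cycle del: power_Suc One_nat_def)
  also have "\<dots> = (\<Sum>\<sigma>\<in>cyclic_perms ?T. t ^ card (excedances ?T \<sigma>))"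
    by (rule sum.reindex_bij_betw[OF word_cycle_bij])
  also have "\<dots> = stat_sum ?T (\<lambda>k a d. t ^ k * t ^ a * 1 ^ d)"
    unfolding stat_sum_def
    by (intro sum.cong refl) (simp add: card_excedances_cyclic power_add)
  also have "\<dots> = gamma_poly n 1 0 t (t + 1)"
    by (rule stat_sum_monomial) auto
  finally show ?thesis by (simp add: add.commute)
qed

section \<open>The generating function of cyclic permutations\<close>

definition w_ser :: qs_fps where
  "w_ser = exact_quot (1 + u_ser) (1 + u_ser * v_ser)"

lemma one_plus_uv_nonzero: "1 + u_ser * v_ser \<noteq> 0" and one_minus_u_nonzero: "1 - u_ser \<noteq> 0"
proof -
  have "fps_nth (1 + u_ser * v_ser) 0 \<noteq> 0" "fps_nth (1 - u_ser) 0 \<noteq> 0"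
    by (simp_all add: u_ser_props(2))
  then show "1 + u_ser * v_ser \<noteq> 0" "1 - u_ser \<noteq> 0"
    by (metis fps_zero_nth)+
qed

lemma two_nonzero: "(2 :: qs_fps) \<noteq> 0"
proof -
  have "fps_nth (2 :: qs_fps) 0 = 2"
    by (simp add: fps_numeral_nth)
  then show ?thesis
    by (metis fps_zero_nth zero_neq_numeral)
qed

text \<open>Clearing the denominators of \<open>u_ser\<close> and \<open>v_ser\<close> leaves a
  polynomial identity in s, t and the root, settled by the square of the root.\<close>

lemma t_times_one_plus_uv: "t_var * (1 + u_ser * v_ser) = u_ser + v_ser"
proof -
  note H = u_ser_props(1) v_ser_props(1) root_ser_props(1)
  have "(2 * (1 - s_var) * t_var) * (2 * s_var * t_var) *
      (t_var * (1 + u_ser * v_ser) - (u_ser + v_ser)) = 0"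
    using H by algebra
  then show ?thesis
    using denominators_nonzero by simp
qed

lemma u_quadratic:
  "u_ser = t_var * (1 - s_var) + t_var * ((2 * s_var - t_var) * u_ser + (1 - s_var) * u_ser ^ 2)"
proof -
  note H = u_ser_props(1) root_ser_props(1)
  \<comment> \<open>This factor completes the quadratic to a square, where the value of
    \<open>root_ser ^ 2\<close> applies.\<close>
  have "2 * (2 * (1 - s_var) * t_var) *
      (u_ser - (t_var * (1 - s_var) + t_var * ((2 * s_var - t_var) * u_ser + (1 - s_var) * u_ser ^ 2))) = 0"
    using H by algebra
  then show ?thesis
    using denominators_nonzero two_nonzero by simp
qed

lemma st_times_square: "v_ser * (1 + u_ser) ^ 2 = s_var * t_var * (1 + u_ser * v_ser) ^ 2"
proof -
  \<comment> \<open>The quadratic for u reads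
    \<open>s * t * (1 - u) ^ 2 = (t - u) * (1 - t * u)\<close>, so the factor
    \<open>(1 - u) ^ 2\<close> eliminates s. The relation \<open>t * (1 + u * v) = u + v\<close>
    gives \<open>t - u = v * (1 - t * u)\<close> and
    \<open>(1 - t * u) * (1 + u * v) = 1 - u ^ 2\<close>.\<close>
  have "(1 - u_ser) ^ 2 * (v_ser * (1 + u_ser) ^ 2 - s_var * t_var * (1 + u_ser * v_ser) ^ 2) = 0"
    using t_times_one_plus_uv u_quadratic by algebra
  then show ?thesis
    using one_minus_u_nonzero by simp
qed

text \<open>The second equation is \<open>(1 + u) * (1 + v) = (1 + t) * (1 + u * v)\<close>, which
  follows from \<open>u + v = t * (1 + u * v)\<close>.\<close>

lemma w_ser_square: "w_ser ^ 2 * v_ser = s_var * t_var"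
  and w_ser_one_plus_v: "w_ser * (1 + v_ser) = 1 + t_var"
proof -
  have w: "w_ser * (1 + u_ser * v_ser) = 1 + u_ser"
    unfolding w_ser_def by (rule exact_quot_one_plus_uv)
  have "(1 + u_ser * v_ser) ^ 2 * (w_ser ^ 2 * v_ser - s_var * t_var) = 0"
    using w st_times_square by algebra
  then show "w_ser ^ 2 * v_ser = s_var * t_var"
    using one_plus_uv_nonzero by simp
  have "(1 + u_ser * v_ser) * (w_ser * (1 + v_ser) - (1 + t_var)) = 0"
    using w t_times_one_plus_uv by algebra
  then show "w_ser * (1 + v_ser) = 1 + t_var"
    using one_plus_uv_nonzero by simp
qed

section \<open>Weights of single cycles\<close>

definition perm_weight :: "nat set \<Rightarrow> (nat \<Rightarrow> nat) \<Rightarrow> qs_fps" where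
  "perm_weight T \<pi> = s_var ^ card (valleys T \<pi>) * t_var ^ card (excedances T \<pi>)"

text \<open>A fixed point carries no power of \<open>w_ser\<close>; this exception produces the
  exponent \<open>n - count lam 1\<close> in the end.\<close>

definition cycle_series :: "nat \<Rightarrow> qs_fps" where
  "cycle_series i = (if i = 1 then 1 else w_ser ^ i) * poly (eulerian_poly (i - 1)) v_ser"

text \<open>Beyond one point a valley is an excedance and weighs \<open>s * t\<close>, a double
  ascent weighs \<open>t\<close>, a double descent 1. Homogeneity then extracts \<open>w_ser\<close>
  to the number of points and leaves an Eulerian polynomial at v.\<close>

lemma sum_perm_weight_cyclic:
  assumes T: "finite T" "T \<noteq> {}"
  shows "(\<Sum>\<pi>\<in>cyclic_perms T. perm_weight T \<pi>) = cycle_series (card T)"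
proof (cases "card T = 1")
  case True
  then obtain x where "T = {x}" by (auto simp: card_1_singleton_iff)
  then show ?thesis
    by (simp add: cyclic_perms_singleton perm_weight_def valleys_def excedances_def cycle_series_def
        eulerian_poly_def)
next
  case False
  moreover have "card T \<noteq> 0" using T by simp
  ultimately have "card T = (card T - 2) + 2" by simp
  then obtain n where n: "card T = n + 2" by blast
  have "(\<Sum>\<pi>\<in>cyclic_perms T. perm_weight T \<pi>) =
      stat_sum T (\<lambda>k a d. (s_var * t_var) ^ k * t_var ^ a * 1 ^ d)"
    unfolding stat_sum_def perm_weight_def using T n
    by (intro sum.cong refl) (simp add: card_excedances_cyclic power_add power_mult_distrib mult_ac)
  also have "\<dots> = gamma_poly n 1 0 (s_var * t_var) (t_var + 1)"
    using T n by (intro stat_sum_monomial) auto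
  also have "\<dots> = gamma_poly n 1 0 (w_ser ^ 2 * v_ser) (w_ser * (1 + v_ser))"
    by (simp only: w_ser_square w_ser_one_plus_v add.commute[of t_var])
  also have "\<dots> = w_ser ^ (n + 2) * poly (eulerian_poly (Suc n)) v_ser"
    by (simp add: gamma_poly_homogeneous poly_eulerian_eq_gamma_poly)
  finally show ?thesis
    by (simp add: cycle_series_def n)
qed

section \<open>Splitting off the cycle of a point\<close>

text \<open>Stated for arbitrary sets because removing a cycle from an interval leaves an arbitrary
  subset.\<close>

definition perms_with_type :: "'a set \<Rightarrow> nat multiset \<Rightarrow> ('a \<Rightarrow> 'a) set" where
  "perms_with_type B lam =
     {\<pi>. \<pi> permutes B \<and> image_mset card (mset_set (orbit \<pi> ` B)) = lam}"

lemma finite_perms_with_type: "finite B \<Longrightarrow> finite (perms_with_type B lam)"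
  unfolding perms_with_type_def
  by (rule finite_subset[OF _ finite_permutations[of B]]) auto

section \<open>Composing a cycle with a permutation of its complement\<close>

context
  fixes B T :: "'a set" and \<sigma> \<rho> :: "'a \<Rightarrow> 'a"
  assumes B: "finite B" and T: "T \<subseteq> B"
    and \<sigma>: "\<sigma> \<in> cyclic_perms T" and \<rho>: "\<rho> permutes B - T"
begin

lemma cycle_part_permutes: "\<sigma> permutes T"
  using \<sigma> by (simp add: cyclic_perms_def)

lemma comp_apply_in: "x \<in> T \<Longrightarrow> (\<sigma> \<circ> \<rho>) x = \<sigma> x"
  using permutes_not_in[OF \<rho>, of x] by simp

lemma comp_apply_out:
  assumes "x \<in> B - T"
  shows "(\<sigma> \<circ> \<rho>) x = \<rho> x"
  using permutes_not_in[OF cycle_part_permutes, of "\<rho> x"] permutes_in_image[OF \<rho>, of x] assms by simp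

lemma comp_permutes: "\<sigma> \<circ> \<rho> permutes B"
  using T by (intro permutes_compose permutes_subset[OF \<rho>] permutes_subset[OF cycle_part_permutes]) auto

lemma orbit_comp_in:
  assumes "x \<in> T"
  shows "orbit (\<sigma> \<circ> \<rho>) x = T"
proof -
  have "orbit (\<sigma> \<circ> \<rho>) x = orbit \<sigma> x"
    using assms permutes_in_image[OF cycle_part_permutes]
    by (intro orbit_cong0[of x T] comp_apply_in) (auto simp: comp_apply_in simp del: o_apply)
  then show ?thesis
    using \<sigma> assms by (simp add: cyclic_perms_def orbit_cyclic_eq3)
qed

lemma orbit_comp_out:
  assumes "x \<in> B - T"
  shows "orbit (\<sigma> \<circ> \<rho>) x = orbit \<rho> x"
  using assms permutes_in_image[OF \<rho>]
  by (intro orbit_cong0[of x "B - T"] comp_apply_out) (auto simp: comp_apply_out simp del: o_apply)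

text \<open>The second claim matters because the type is read off a set of orbits: only a new orbit
  adds exactly one part.\<close>

lemma orbits_comp:
  assumes "T \<noteq> {}"
  shows "orbit (\<sigma> \<circ> \<rho>) ` B = insert T (orbit \<rho> ` (B - T))" "T \<notin> orbit \<rho> ` (B - T)"
proof -
  have "orbit (\<sigma> \<circ> \<rho>) ` B = orbit (\<sigma> \<circ> \<rho>) ` T \<union> orbit (\<sigma> \<circ> \<rho>) ` (B - T)"
    using T by (metis Un_Diff_cancel image_Un sup.absorb2)
  also have "orbit (\<sigma> \<circ> \<rho>) ` T = {T}"
    using assms orbit_comp_in by auto
  also have "orbit (\<sigma> \<circ> \<rho>) ` (B - T) = orbit \<rho> ` (B - T)"
    using orbit_comp_out by (rule image_cong[OF refl])
  finally show "orbit (\<sigma> \<circ> \<rho>) ` B = insert T (orbit \<rho> ` (B - T))"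
    by (simp only: Un_insert_left Un_empty_left)
  show "T \<notin> orbit \<rho> ` (B - T)"
  proof
    assume "T \<in> orbit \<rho> ` (B - T)"
    then have "T \<subseteq> B - T"
      using permutes_orbit_subset[OF \<rho>] by blast
    with assms show False by blast
  qed
qed

lemma type_comp:
  assumes "T \<noteq> {}"
  shows "image_mset card (mset_set (orbit (\<sigma> \<circ> \<rho>) ` B)) =
    add_mset (card T) (image_mset card (mset_set (orbit \<rho> ` (B - T))))"
  using orbits_comp[OF assms] B by simp

lemma perm_restrict_comp_in: "perm_restrict (\<sigma> \<circ> \<rho>) T = \<sigma>"
  using permutes_not_in[OF cycle_part_permutes]
  by (auto simp: fun_eq_iff perm_restrict_def comp_apply_in simp del: o_apply)

lemma perm_restrict_comp_out: "perm_restrict (\<sigma> \<circ> \<rho>) (B - T) = \<rho>"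
proof
  show "perm_restrict (\<sigma> \<circ> \<rho>) (B - T) x = \<rho> x" for x
    using permutes_not_in[OF \<rho>, of x] comp_apply_out[of x] by (simp add: perm_restrict_def)
qed

lemma inv_comp_in:
  assumes "x \<in> T"
  shows "inv (\<sigma> \<circ> \<rho>) x = inv \<sigma> x"
proof -
  have "inv \<sigma> x \<in> T"
    using assms permutes_in_image[OF permutes_inv[OF cycle_part_permutes]] by simp
  then have "(\<sigma> \<circ> \<rho>) (inv \<sigma> x) = x"
    using permutes_inverses[OF cycle_part_permutes] by (simp add: comp_apply_in del: o_apply)
  then show ?thesis
    using permutes_inj[OF comp_permutes] by (intro inv_f_eq)
qed

lemma inv_comp_out:
  assumes "x \<in> B - T"
  shows "inv (\<sigma> \<circ> \<rho>) x = inv \<rho> x"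
proof -
  have "inv \<rho> x \<in> B - T"
    using assms permutes_in_image[OF permutes_inv[OF \<rho>]] by simp
  then have "(\<sigma> \<circ> \<rho>) (inv \<rho> x) = x"
    using permutes_inverses[OF \<rho>] by (simp only: comp_apply_out)
  then show ?thesis
    using permutes_inj[OF comp_permutes] by (intro inv_f_eq)
qed

end

text \<open>Images and preimages of a point stay on its side of the splitting, so both statistics
  are additive.\<close>

lemma perm_weight_comp:
  assumes B: "finite B" and T: "T \<subseteq> B" and \<sigma>: "\<sigma> \<in> cyclic_perms T" and \<rho>: "\<rho> permutes B - T"
  shows "perm_weight B (\<sigma> \<circ> \<rho>) = perm_weight T \<sigma> * perm_weight (B - T) \<rho>"
proof -
  note c = comp_apply_in[OF assms] comp_apply_out[OF assms] inv_comp_in[OF assms] inv_comp_out[OF assms]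
  have cases: "x \<in> T \<and> x \<in> B \<or> x \<in> B - T \<or> x \<notin> B \<and> x \<notin> T" for x
    using T by blast
  have "x \<in> valleys B (\<sigma> \<circ> \<rho>) \<longleftrightarrow> x \<in> valleys T \<sigma> \<union> valleys (B - T) \<rho>" for x
    using cases[of x] c[of x] by (auto simp: valleys_def simp del: o_apply)
  then have "valleys B (\<sigma> \<circ> \<rho>) = valleys T \<sigma> \<union> valleys (B - T) \<rho>" by blast
  moreover have "x \<in> excedances B (\<sigma> \<circ> \<rho>) \<longleftrightarrow> x \<in> excedances T \<sigma> \<union> excedances (B - T) \<rho>" for x
    using cases[of x] c[of x] by (auto simp: excedances_def simp del: o_apply)
  then have "excedances B (\<sigma> \<circ> \<rho>) = excedances T \<sigma> \<union> excedances (B - T) \<rho>" by blast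
  moreover have "finite T" using B T by (rule rev_finite_subset)
  moreover have "valleys T \<sigma> \<inter> valleys (B - T) \<rho> = {}" "excedances T \<sigma> \<inter> excedances (B - T) \<rho> = {}"
    by (auto simp: valleys_def excedances_def)
  ultimately show ?thesis
    using B by (simp add: perm_weight_def card_Un_disjoint finite_stats power_add)
qed

text \<open>The inverse restricts a permutation to \<open>T\<close> and to
  \<open>B - T\<close>.\<close>

lemma bij_betw_split_cycle:
  assumes B: "finite B" and T: "T \<subseteq> B" and b: "b \<in> T" and lam: "card T \<in># lam"
  shows "bij_betw (\<lambda>(\<sigma>, \<rho>). \<sigma> \<circ> \<rho>) (cyclic_perms T \<times> perms_with_type (B - T) (lam - {#card T#}))
    {\<pi> \<in> perms_with_type B lam. orbit \<pi> b = T}"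
  (is "bij_betw ?f ?X ?Y")
proof (rule bij_betwI)
  let ?g = "\<lambda>\<pi>. (perm_restrict \<pi> T, perm_restrict \<pi> (B - T))"
  have ne: "T \<noteq> {}" using b by auto
  show "?f \<in> ?X \<rightarrow> ?Y"
  proof safe
    fix \<sigma> \<rho> assume \<sigma>: "\<sigma> \<in> cyclic_perms T" and \<rho>: "\<rho> \<in> perms_with_type (B - T) (lam - {#card T#})"
    then have \<rho>': "\<rho> permutes B - T" by (simp add: perms_with_type_def)
    show "\<sigma> \<circ> \<rho> \<in> perms_with_type B lam"
      using \<rho> lam comp_permutes[OF B T \<sigma> \<rho>'] type_comp[OF B T \<sigma> \<rho>' ne]
      by (simp add: perms_with_type_def del: o_apply)
    show "x \<in> T" if "x \<in> orbit (\<sigma> \<circ> \<rho>) b" for x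
      using that orbit_comp_in[OF B T \<sigma> \<rho>' b] by blast
    show "x \<in> orbit (\<sigma> \<circ> \<rho>) b" if "x \<in> T" for x
      using that orbit_comp_in[OF B T \<sigma> \<rho>' b] by blast
  qed
  have \<pi>: "perm_restrict \<pi> T \<in> cyclic_perms T" "perm_restrict \<pi> (B - T) permutes B - T"
    "perm_restrict \<pi> T \<circ> perm_restrict \<pi> (B - T) = \<pi>" if "\<pi> \<in> ?Y" for \<pi>
  proof -
    have perm: "\<pi> permutes B" and orb: "orbit \<pi> b = T"
      using that by (auto simp: perms_with_type_def)
    have cyc: "cyclic_on \<pi> T"
      using cyclic_on_orbit[OF perm B, of b] orb by simp
    show \<rho>: "perm_restrict \<pi> (B - T) permutes B - T"
      by (rule perm_restrict_diff_cyclic[OF perm cyc])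
    have "\<pi> ` T \<subseteq> T"
      using cyclic_on_inI[OF cyc] by blast
    moreover have "inj_on \<pi> T"
      using permutes_inj[OF perm] by (rule inj_on_subset) simp
    ultimately have "bij_betw \<pi> T T"
      using rev_finite_subset[OF B T] by (simp add: bij_betw_def endo_inj_surj)
    then have "bij_betw (perm_restrict \<pi> T) T T"
      by (rule bij_betw_cong[THEN iffD1, rotated]) (simp add: perm_restrict_def)
    then have \<sigma>: "perm_restrict \<pi> T permutes T"
      by (rule bij_imp_permutes) (simp add: perm_restrict_def)
    with cyc show "perm_restrict \<pi> T \<in> cyclic_perms T"
      by (simp add: cyclic_perms_def cyclic_on_perm_restrict)
    have "T \<union> (B - T) = B" using T by blast
    then show "perm_restrict \<pi> T \<circ> perm_restrict \<pi> (B - T) = \<pi>"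
      using perm_restrict_union[OF \<sigma> \<rho>] perm_restrict_id[OF perm] by simp
  qed
  show "?g \<in> ?Y \<rightarrow> ?X"
  proof
    fix \<pi> assume Y: "\<pi> \<in> ?Y"
    have "lam = add_mset (card T) (image_mset card (mset_set (orbit (perm_restrict \<pi> (B - T)) ` (B - T))))"
      using type_comp[OF B T \<pi>(1,2)[OF Y] ne] Y unfolding \<pi>(3)[OF Y] by (simp add: perms_with_type_def)
    with \<pi>(1,2)[OF Y] show "?g \<pi> \<in> ?X"
      by (simp add: perms_with_type_def)
  qed
  show "?f (?g \<pi>) = \<pi>" if "\<pi> \<in> ?Y" for \<pi>
    using \<pi>(3)[OF that] by simp
  show "?g (?f p) = p" if "p \<in> ?X" for p
  proof -
    from that obtain \<sigma> \<rho> where p: "p = (\<sigma>, \<rho>)" "\<sigma> \<in> cyclic_perms T" "\<rho> permutes B - T"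
      by (auto simp: perms_with_type_def)
    then show ?thesis
      using perm_restrict_comp_in[OF B T p(2,3)] perm_restrict_comp_out[OF B T p(2,3)]
      by (simp del: o_apply)
  qed
qed

section \<open>Generating function of a cycle type\<close>

definition type_series :: "nat set \<Rightarrow> nat multiset \<Rightarrow> qs_fps" where
  "type_series B lam = (\<Sum>\<pi>\<in>perms_with_type B lam. perm_weight B \<pi>)"

text \<open>The permutations are grouped by the orbit \<open>T\<close> of \<open>b\<close>; on each
  group the weight factors over the cycle and the rest.\<close>

lemma type_series_rec:
  assumes B: "finite B" and b: "b \<in> B"
  shows "type_series B lam =
    (\<Sum>T | b \<in> T \<and> T \<subseteq> B \<and> card T \<in># lam. cycle_series (card T) * type_series (B - T) (lam - {#card T#}))"
proof -
  let ?TT = "{T. b \<in> T \<and> T \<subseteq> B \<and> card T \<in># lam}"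
  have "(\<lambda>\<pi>. orbit \<pi> b) ` perms_with_type B lam \<subseteq> ?TT"
  proof clarify
    fix \<pi> assume \<pi>: "\<pi> \<in> perms_with_type B lam"
    then have perm: "\<pi> permutes B" by (simp add: perms_with_type_def)
    have "orbit \<pi> b \<in># mset_set (orbit \<pi> ` B)"
      using B b by simp
    then have "card (orbit \<pi> b) \<in># lam"
      using \<pi> by (auto simp: perms_with_type_def)
    then show "b \<in> orbit \<pi> b \<and> orbit \<pi> b \<subseteq> B \<and> card (orbit \<pi> b) \<in># lam"
      using orbit_of_permutes_self[OF perm B] permutes_orbit_subset[OF perm b] by simp
  qed
  then have "type_series B lam =
      (\<Sum>T\<in>?TT. \<Sum>\<pi> | \<pi> \<in> perms_with_type B lam \<and> orbit \<pi> b = T. perm_weight B \<pi>)"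
    unfolding type_series_def using B
    by (intro sum.group[symmetric]) (auto simp: finite_perms_with_type)
  also have "\<dots> = (\<Sum>T\<in>?TT. cycle_series (card T) * type_series (B - T) (lam - {#card T#}))"
  proof (rule sum.cong[OF refl])
    fix T assume "T \<in> ?TT"
    then have T: "T \<subseteq> B" "b \<in> T" "card T \<in># lam" by auto
    have "(\<Sum>\<pi> | \<pi> \<in> perms_with_type B lam \<and> orbit \<pi> b = T. perm_weight B \<pi>) =
      (\<Sum>(\<sigma>, \<rho>)\<in>cyclic_perms T \<times> perms_with_type (B - T) (lam - {#card T#}). perm_weight B (\<sigma> \<circ> \<rho>))"
      using sum.reindex_bij_betw[OF bij_betw_split_cycle[OF B T], of "perm_weight B"]
      by (simp add: split_def)
    also have "\<dots> = (\<Sum>(\<sigma>, \<rho>)\<in>cyclic_perms T \<times> perms_with_type (B - T) (lam - {#card T#}).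
        perm_weight T \<sigma> * perm_weight (B - T) \<rho>)"
      using perm_weight_comp[OF B T(1)] by (intro sum.cong) (auto simp: perms_with_type_def)
    also have "\<dots> = (\<Sum>\<sigma>\<in>cyclic_perms T. perm_weight T \<sigma>) * type_series (B - T) (lam - {#card T#})"
      by (simp add: type_series_def sum_product sum.cartesian_product)
    also have "(\<Sum>\<sigma>\<in>cyclic_perms T. perm_weight T \<sigma>) = cycle_series (card T)"
      using T B by (intro sum_perm_weight_cyclic) (auto intro: finite_subset)
    finally show "(\<Sum>\<pi> | \<pi> \<in> perms_with_type B lam \<and> orbit \<pi> b = T. perm_weight B \<pi>) =
      cycle_series (card T) * type_series (B - T) (lam - {#card T#})" .
  qed
  finally show ?thesis .
qed

lemma card_subsets_containing:
  assumes B: "finite B" and b: "b \<in> B" and i: "i \<ge> 1"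
  shows "card {T. b \<in> T \<and> T \<subseteq> B \<and> card T = i} = (card B - 1) choose (i - 1)"
proof -
  have "bij_betw (insert b) {S. S \<subseteq> B - {b} \<and> card S = i - 1} {T. b \<in> T \<and> T \<subseteq> B \<and> card T = i}"
  proof (rule bij_betwI[where g = "\<lambda>T. T - {b}"])
    show "insert b \<in> {S. S \<subseteq> B - {b} \<and> card S = i - 1} \<rightarrow> {T. b \<in> T \<and> T \<subseteq> B \<and> card T = i}"
    proof
      fix S assume "S \<in> {S. S \<subseteq> B - {b} \<and> card S = i - 1}"
      then have S: "S \<subseteq> B - {b}" "card S = i - 1" by auto
      then have "finite S" "b \<notin> S" using B by (auto intro: finite_subset)
      then show "insert b S \<in> {T. b \<in> T \<and> T \<subseteq> B \<and> card T = i}"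
        using S b i by auto
    qed
  qed auto
  then have "card {T. b \<in> T \<and> T \<subseteq> B \<and> card T = i} = card {S. S \<subseteq> B - {b} \<and> card S = i - 1}"
    by (simp add: bij_betw_same_card)
  also have "\<dots> = (card B - 1) choose (i - 1)"
    using B b by (subst n_subsets) auto
  finally show ?thesis .
qed

lemma z_partition_superset:
  assumes "finite S" "set_mset lam \<subseteq> S"
  shows "z_partition lam = (\<Prod>i\<in>S. i ^ count lam i * fact (count lam i))"
  unfolding z_partition_def using assms
  by (intro prod.mono_neutral_left) (auto simp: not_in_iff)

lemma z_partition_add_mset:
  "z_partition (add_mset i lam) = i * (count lam i + 1) * z_partition lam"
proof -
  \<comment> \<open>Including \<open>i\<close> is harmless when \<open>lam\<close> lacks it: its
    factor is then \<open>i ^ 0 * fact 0 = 1\<close>.\<close>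
  let ?S = "insert i (set_mset lam)"
  have "z_partition (add_mset i lam) = i ^ (count lam i + 1) * fact (count lam i + 1) *
      (\<Prod>j\<in>?S - {i}. j ^ count lam j * fact (count lam j))"
    by (subst z_partition_superset[of ?S]) (auto simp: prod.remove[of ?S i] intro!: prod.cong)
  also have "\<dots> = i * (count lam i + 1) * (i ^ count lam i * fact (count lam i) *
      (\<Prod>j\<in>?S - {i}. j ^ count lam j * fact (count lam j)))"
    by (simp add: algebra_simps)
  also have "i ^ count lam i * fact (count lam i) *
      (\<Prod>j\<in>?S - {i}. j ^ count lam j * fact (count lam j)) = z_partition lam"
    by (subst z_partition_superset[of ?S]) (auto simp: prod.remove[of ?S i])
  finally show ?thesis .
qed

lemma z_partition_remove:
  assumes "i \<in># lam"
  shows "z_partition lam = i * count lam i * z_partition (lam - {#i#})"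
proof -
  obtain mu where "lam = add_mset i mu"
    using assms by (meson mset_add)
  then show ?thesis by (simp add: z_partition_add_mset)
qed

lemma sum_mset_count: "sum_mset lam = (\<Sum>i\<in>set_mset lam. i * count lam i)" for lam :: "nat multiset"
proof -
  \<comment> \<open>The index set is fixed in advance, since \<open>set_mset lam\<close> may grow
    during the induction.\<close>
  have "sum_mset lam = (\<Sum>i\<in>S. i * count lam i)" if "finite S" "set_mset lam \<subseteq> S" for S
    using that(2)
  proof (induction lam)
    case (add x lam)
    have "(\<Sum>i\<in>S. i * count (add_mset x lam) i) = (\<Sum>i\<in>S. i * count lam i + (if i = x then x else 0))"
      by (rule sum.cong) auto
    with add that(1) show ?case by (simp add: sum.distrib)
  qed simp
  then show ?thesis by simp
qed

lemma rat_const_mult: "rat_const (a * b) = rat_const a * rat_const b"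
  by (simp add: rat_const_def)

lemma rat_const_add: "rat_const (a + b) = rat_const a + rat_const b"
  by (simp add: rat_const_def)

lemma rat_const_0: "rat_const 0 = 0" and rat_const_1: "rat_const 1 = 1"
  by (simp_all add: rat_const_def one_pCons[symmetric])

lemma rat_const_sum: "rat_const (\<Sum>i\<in>S. f i) = (\<Sum>i\<in>S. rat_const (f i))"
  by (induction S rule: infinite_finite_induct) (simp_all add: rat_const_0 rat_const_add)

text \<open>Induction on the number of parts, splitting off the cycle through a chosen
  point.\<close>

lemma type_series_formula:
  assumes "finite B" "card B = sum_mset lam" "0 \<notin># lam"
  shows "type_series B lam = rat_const (fact (card B) / of_nat (z_partition lam)) *
    (\<Prod>i\<in>#lam. rat_const (1 / fact (i - 1)) * cycle_series i)"
  using assms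
proof (induction "size lam" arbitrary: B lam)
  case 0
  then have "B = {}" "lam = {#}" by auto
  then show ?case
    by (simp add: type_series_def perms_with_type_def perm_weight_def valleys_def excedances_def
        z_partition_def rat_const_1)
next
  case (Suc k)
  let ?n = "card B"
  let ?c = "\<lambda>i. rat_const (1 / fact (i - 1)) * cycle_series i"
  let ?P = "\<Prod>i\<in>#lam. ?c i"
  have "lam \<noteq> {#}" using Suc.hyps(2) by auto
  then obtain j where "j \<in># lam" by blast
  moreover have "j \<noteq> 0" using \<open>j \<in># lam\<close> Suc.prems by metis
  ultimately have n: "?n > 0"
    using Suc.prems(2) by (metis gr0I sum_mset_0_iff)
  then have "B \<noteq> {}" by auto
  then obtain b where b: "b \<in> B" by blast
  \<comment> \<open>The cycle on \<open>T\<close> supplies the factor of \<open>?P\<close> missing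
    from the smaller type, and \<open>z_partition_remove\<close> restores the full denominator. Only
    \<open>card T\<close> still enters the scalar.\<close>
  have step: "cycle_series (card T) * type_series (B - T) (lam - {#card T#}) =
      rat_const (fact (card T - 1) * fact (?n - card T) * of_nat (card T * count lam (card T)) /
        of_nat (z_partition lam)) * ?P"
    if T: "T \<subseteq> B" "card T \<in># lam" for T
  proof -
    let ?i = "card T"
    let ?mu = "lam - {#?i#}"
    have fT: "finite T" using T Suc.prems(1) by (auto intro: finite_subset)
    have lam: "lam = add_mset ?i ?mu" using T by simp
    have "sum_mset lam = ?i + sum_mset ?mu" by (subst lam) simp
    then have "card (B - T) = sum_mset ?mu"
      using Suc.prems(2) T fT by (simp add: card_Diff_subset)
    moreover have "size ?mu = k" using Suc.hyps(2) T by (simp add: size_Diff_singleton)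
    moreover have "0 \<notin># ?mu" using Suc.prems(3) by (meson in_diffD)
    moreover have "card (B - T) = ?n - ?i" using T fT by (simp add: card_Diff_subset)
    ultimately have ts: "type_series (B - T) ?mu =
        rat_const (fact (?n - ?i) / of_nat (z_partition ?mu)) * (\<Prod>i\<in>#?mu. ?c i)"
      using Suc.prems(1) Suc.hyps(1)[of ?mu "B - T"] by simp
    have cs: "rat_const (fact (?i - 1)) * ?c ?i = cycle_series ?i"
      by (simp add: mult.assoc[symmetric] rat_const_mult[symmetric] rat_const_1)
    have "cycle_series ?i * type_series (B - T) ?mu = (rat_const (fact (?i - 1)) * ?c ?i) *
        (rat_const (fact (?n - ?i) / of_nat (z_partition ?mu)) * (\<Prod>i\<in>#?mu. ?c i))"
      by (simp only: cs ts)
    also have "\<dots> = rat_const (fact (?i - 1) * (fact (?n - ?i) / of_nat (z_partition ?mu))) *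
        (?c ?i * (\<Prod>i\<in>#?mu. ?c i))"
      by (simp only: rat_const_mult mult_ac)
    also have "?c ?i * (\<Prod>i\<in>#?mu. ?c i) = (\<Prod>i\<in>#add_mset ?i ?mu. ?c i)"
      by (simp only: image_mset_add_mset prod_mset.add_mset)
    also have "add_mset ?i ?mu = lam"
      by (rule lam[symmetric])
    also have "fact (?i - 1) * (fact (?n - ?i) / of_nat (z_partition ?mu)) =
        (fact (?i - 1) * fact (?n - ?i) * of_nat (?i * count lam ?i) / of_nat (z_partition lam) :: rat)"
    proof -
      have "?i > 0" "count lam ?i > 0" using T Suc.prems(3) by (metis gr0I, simp)
      then show ?thesis
        unfolding z_partition_remove[OF T(2)] by (simp add: field_simps count_eq_zero_iff)
    qed
    finally show ?thesis .
  qed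
  let ?TT = "{T. b \<in> T \<and> T \<subseteq> B \<and> card T \<in># lam}"
  let ?h = "\<lambda>i. fact (i - 1) * fact (?n - i) * of_nat (i * count lam i) / of_nat (z_partition lam) :: rat"
  have "type_series B lam = (\<Sum>T\<in>?TT. rat_const (?h (card T)) * ?P)"
    unfolding type_series_rec[OF Suc.prems(1) b] by (intro sum.cong refl step) auto
  also have "\<dots> = rat_const (\<Sum>T\<in>?TT. ?h (card T)) * ?P"
    by (simp only: rat_const_sum sum_distrib_right)
  also have "(\<Sum>T\<in>?TT. ?h (card T)) = (\<Sum>i\<in>set_mset lam. \<Sum>T | T \<in> ?TT \<and> card T = i. ?h (card T))"
    using Suc.prems(1) by (intro sum.group[symmetric]) auto
  \<comment> \<open>The number of sets of size \<open>i\<close> containing \<open>b\<close> is a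
    binomial coefficient that cancels both factorials. The remaining numbers
    \<open>i * count lam i\<close> add up to \<open>card B\<close>.\<close>
  also have "\<dots> = (\<Sum>i\<in>set_mset lam. fact (?n - 1) * of_nat (i * count lam i) / of_nat (z_partition lam))"
  proof (rule sum.cong[OF refl])
    fix i assume i: "i \<in># lam"
    have "i \<noteq> 0" using i Suc.prems(3) by metis
    then have i1: "i \<ge> 1" by simp
    have "i \<le> ?n"
      using i Suc.prems(2) by (metis sum_mset.remove le_add1)
    have "{T. T \<in> ?TT \<and> card T = i} = {T. b \<in> T \<and> T \<subseteq> B \<and> card T = i}"
      using i by auto
    then have "(\<Sum>T | T \<in> ?TT \<and> card T = i. ?h (card T)) = of_nat ((?n - 1) choose (i - 1)) * ?h i"
      using card_subsets_containing[OF Suc.prems(1) b i1] by simp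
    also have "of_nat ((?n - 1) choose (i - 1)) = (fact (?n - 1) / (fact (i - 1) * fact (?n - i)) :: rat)"
      using binomial_fact[of "i - 1" "?n - 1", where 'a = rat] i1 \<open>i \<le> ?n\<close> by simp
    finally show "(\<Sum>T | T \<in> ?TT \<and> card T = i. ?h (card T)) =
        fact (?n - 1) * of_nat (i * count lam i) / of_nat (z_partition lam)"
      by simp
  qed
  also have "\<dots> = fact (?n - 1) * of_nat (\<Sum>i\<in>set_mset lam. i * count lam i) / of_nat (z_partition lam)"
    by (simp only: of_nat_sum sum_distrib_left sum_divide_distrib)
  also have "\<dots> = fact ?n / of_nat (z_partition lam)"
    using Suc.prems(2) n by (simp add: sum_mset_count[symmetric] fact_reduce mult.commute)
  finally show ?case .
qed

theorem theorem1:
  fixes n :: nat and lam :: "nat multiset"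
  assumes "n \<ge> 1"
    and "partition_of lam n"
  shows "(\<Sum>\<pi>\<in>perms_of_type n lam. s_var ^ cval n \<pi> * t_var ^ exc n \<pi>) =
    rat_const (fact n / of_nat (z_partition lam)) *
    exact_quot (1 + u_ser) (1 + u_ser * v_ser) ^ (n - count lam 1) *
    (\<Prod>i\<in>set_mset lam.
       (rat_const (1 / fact (i - 1)) * poly (eulerian_poly (i - 1)) v_ser) ^ count lam i)"
proof -
  have lam: "0 \<notin># lam" "sum_mset lam = n"
    using assms(2) by (auto simp: partition_of_def)
  let ?a = "\<lambda>i. rat_const (1 / fact (i - 1)) * poly (eulerian_poly (i - 1)) v_ser"
  \<comment> \<open>The exponent of \<open>w_ser\<close> from all cycles of size \<open>i\<close>:
    none for fixed points, otherwise the number of points they cover.\<close>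
  let ?e = "\<lambda>i. if i = 1 then 0 else i * count lam i"
  have "n = (\<Sum>i\<in>set_mset lam. (if i = 1 then count lam 1 else 0) + ?e i)"
    unfolding lam(2)[symmetric] sum_mset_count by (rule sum.cong) auto
  also have "\<dots> = count lam 1 + (\<Sum>i\<in>set_mset lam. ?e i)"
    by (simp add: sum.distrib not_in_iff)
  finally have e: "n - count lam 1 = (\<Sum>i\<in>set_mset lam. ?e i)" by simp
  have "(\<Sum>\<pi>\<in>perms_of_type n lam. s_var ^ cval n \<pi> * t_var ^ exc n \<pi>) = type_series {1..n} lam"
    unfolding type_series_def perms_of_type_def perms_with_type_def perm_weight_def cycle_type_def
      cval_def exc_def valleys_def excedances_def ..
  also have "\<dots> = rat_const (fact n / of_nat (z_partition lam)) *
      (\<Prod>i\<in>#lam. rat_const (1 / fact (i - 1)) * cycle_series i)"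
    using type_series_formula[of "{1..n}" lam] lam by simp
  also have "(\<Prod>i\<in>#lam. rat_const (1 / fact (i - 1)) * cycle_series i) =
      (\<Prod>i\<in>set_mset lam. (rat_const (1 / fact (i - 1)) * cycle_series i) ^ count lam i)"
    by (rule image_prod_mset_multiplicity)
  also have "\<dots> = (\<Prod>i\<in>set_mset lam. w_ser ^ ?e i * ?a i ^ count lam i)"
    by (rule prod.cong)
      (auto simp: cycle_series_def power_mult_distrib power_mult mult_ac)
  also have "\<dots> = w_ser ^ (n - count lam 1) * (\<Prod>i\<in>set_mset lam. ?a i ^ count lam i)"
    by (simp only: prod.distrib power_sum e)
  finally show ?thesis
    by (simp only: w_ser_def mult.assoc)
qed

end
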